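(* Not every pseudoalgebra over the pseudomonad $\mathsf{Diag}$ on $\mathsf{CAT}$ is given by a cocomplete category with a choice of colimits. That is, there exists a pseudoalgebra $(\mathsf{A},e,\iota,\gamma)$ over $\mathsf{Diag}$ which is not of the following form: $\mathsf{A}$ is a cocomplete category equipped with a choice of colimit for each small diagram, and $e:\mathsf{Diag}(\mathsf{A})\to\mathsf{A}$ is the functor given by the chosen colimits.
   Context: $\mathsf{CAT}$ is the 2-category of (possibly large) locally small categories. Cocomplete means locally small with all small colimits. The pseudomonad $\mathsf{Diag}$. For $\mathsf{C}$ locally small, $\mathsf{Diag}(\mathsf{C})$ is the category whose objects are small diagrams $(\mathsf{J},D:\mathsf{J}\to\mathsf{C})$ ($\mathsf{J}$ small) and whose morphisms $(\mathsf{J},D)\to(\mathsf{J}',D')$ are pairs $(R:\mathsf{J}\to\mathsf{J}',\ \rho:D\Rightarrow D'\circ R)$. A functor $F:\mathsf{C}\to\mathsf{D}$ induces $F_*:\mathsf{Diag}(\mathsf{C})\to\mathsf{Diag}(\mathsf{D})$ by postcomposition and whiskering; a natural transformation $\alpha:F\Rightarrow G$ induces $\alpha_*$ with components $(\mathrm{id}_{\mathsf{J}},\alpha D)$. This is a strict 2-functor $\mathsf{CAT}\to\mathsf{CAT}$. Unit $\eta:\mathsf{C}\to\mathsf{Diag}(\mathsf{C})$: $C\mapsto(C:\mathsf{1}\to\mathsf{C})$, $f\mapsto(\mathrm{id}_{\mathsf 1},f)$. Multiplication $\mu:\mathsf{Diag}(\mathsf{Diag}(\mathsf{C}))\to\mathsf{Diag}(\mathsf{C})$: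 for $D:\mathsf{J}\to\mathsf{Diag}(\mathsf{C})$, write $D(J)=(D_0J,D_1J:D_0J\to\mathsf{C})$ and $D(j)=(D_0j,\ D_1j:D_1J\Rightarrow D_1J'\circ D_0j)$; $\mu(D)$ is the diagram on the Grothendieck construction $\int D_0$ (objects $(J,X)$, $X\in D_0J$; morphisms $(j,f):(J,X)\to(J',X')$ with $f:D_0j(X)\to X'$) given by $(J,X)\mapsto D_1J(X)$, $(j,f)\mapsto D_1J'(f)\circ(D_1j)_X$. On a morphism $(F,\phi)$ with $\phi_J=(\phi_0J,\phi_1J)$, $\mu(F,\phi)$ is the functor $(J,X)\mapsto(FJ,\phi_0J(X))$, $(j,f:D_0j(X)\to X')\mapsto(Fj,\phi_0J'(f))$, with natural transformation of components $(\phi_1J)_X$. Both $\eta$ and $\mu$ are strictly natural. Unitors and associator: $\ell:\mu\circ\eta_{\mathsf{Diag}}\Rrightarrow\mathrm{id}$, $r:\mathrm{id}\Rrightarrow\mu\circ\eta_*$, $a:\mu\circ\mu_*\Rrightarrow\mu\circ\mu_{\mathsf{Diag}}$ are the isomorphisms of diagrams given on indexing categories by $(\bullet,X)\mapsto X$, $X\mapsto(X,\bullet)$, $(J,(K,L))\mapsto((J,K),L)$, where $\bullet$ is the object of $\mathsf{1}$. Pseudoalgebra over $\mathsf{Diag}$: an object $\mathsf{A}$ of $\mathsf{CAT}$, a functor $e:\mathsf{Diag}(\mathsf{A})\to\mathsf{A}$ and natural isomorphisms $\iota:e\circ\eta_{\mathsf{A}}\Rightarrow\mathrm{id}_{\mathsf{A}}$,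 $\gamma:e\circ e_*\Rightarrow e\circ\mu_{\mathsf{A}}$ such that (whiskerings by juxtaposition) $\gamma\,\eta_*=(e\,r_{\mathsf{A}})\circ(e\,\iota_* )$, and $(e\,a_{\mathsf{A}})\circ(\gamma\,\mu_* )\circ(e\,\gamma_* )=(\gamma\,\mu_{\mathsf{Diag}(\mathsf{A})})\circ(\gamma\,e_{**})$ (using $\mu_{\mathsf{A}}\circ e_{**}=e_*\circ\mu_{\mathsf{Diag}(\mathsf{A})}$). The functor given by chosen colimits: sends $D$ to the chosen colimit object $c(D)$, with chosen colimit cocone $h(D):D\Rightarrow c(D)$, and $(R,\rho):(\mathsf{J},D)\to(\mathsf{J}',D')$ to the unique map $c(R,\rho):c(D)\to c(D')$ with $c(R,\rho)\circ h(D)_J=h(D')_{RJ}\circ\rho_J$ for all $J$. *)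

theory Defs
  imports "HOL-Library.FuncSet"
begin

text \<open>
  HOL has no hierarchy of universes. The universe that separates small from large is a type
  \<open>'u\<close> whose elements are the sets of a full (second-order) model of ZFC, given by the extension
  function \<open>elts\<close>. Up to isomorphism these are the \<open>V\<^sub>\<kappa>\<close> with \<open>\<kappa>\<close> strongly inaccessible,
  that is, the uncountable Grothendieck universes. A class is an arbitrary \<open>'u set\<close>; it is
  small if it is the extension of an element. Choice is inherited from HOL.
\<close>

class universe =
  fixes elts :: "'a \<Rightarrow> 'a set"
  assumes extensionality: "elts x = elts y \<Longrightarrow> x = y"
    and foundation: "wf {(x, y). x \<in> elts y}"
    and separation: "X \<subseteq> elts x \<Longrightarrow> \<exists>z. elts z = X"
    and replacement: "\<exists>z. elts z = f ` elts x"
    and union_set: "\<exists>z. elts z = (\<Union>y\<in>elts x. elts y)"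
    and power_set: "\<exists>z. elts z = {y. elts y \<subseteq> elts x}"
    and infinity: "\<exists>x. infinite (elts x)"

definition small :: "'u::universe set \<Rightarrow> bool"
  where "small X \<longleftrightarrow> (\<exists>x. elts x = X)"

definition set_of :: "'u::universe set \<Rightarrow> 'u"
  where "set_of X = (THE x. elts x = X)"

definition opair :: "'u::universe \<Rightarrow> 'u \<Rightarrow> 'u"
  where "opair x y = set_of {set_of {x}, set_of {x, y}}"

definition pfst :: "'u::universe \<Rightarrow> 'u"
  where "pfst p = (THE x. \<exists>y. p = opair x y)"

definition psnd :: "'u::universe \<Rightarrow> 'u"
  where "psnd p = (THE y. \<exists>x. p = opair x y)"

lemma elts_set_of: "small X \<Longrightarrow> elts (set_of X) = X"
proof -
  assume "small X"
  then obtain x where x: "elts x = X" unfolding small_def by blast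
  then have "(THE y. elts y = X) = x" by (intro the_equality) (auto intro: extensionality)
  with x show ?thesis by (simp add: set_of_def)
qed

lemma small_image: "small X \<Longrightarrow> small ((f :: 'u::universe \<Rightarrow> 'u) ` X)"
proof -
  assume "small X"
  then obtain x where "elts x = X" unfolding small_def by blast
  with replacement[of f x] show ?thesis by (simp add: small_def)
qed

lemma small_pair: "small {x, y :: 'u::universe}"
proof -
  obtain w :: 'u where w: "infinite (elts w)" using infinity by blast
  then have "elts w \<noteq> {}" using finite.emptyI by metis
  then obtain a where a: "a \<in> elts w" by blast
  from w have "infinite (elts w - {a})" by simp
  then have "elts w - {a} \<noteq> {}" using finite.emptyI by metis
  then obtain b where b: "b \<in> elts w" "b \<noteq> a" by blast
  have "small (elts w)" unfolding small_def by blast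
  then have "small ((\<lambda>z. if z = a then x else y) ` elts w)" by (rule small_image)
  moreover have "(\<lambda>z. if z = a then x else y) ` elts w = {x, y}" using a b by auto
  ultimately show ?thesis by simp
qed

lemma set_of_inject: "small X \<Longrightarrow> small Y \<Longrightarrow> set_of X = set_of Y \<longleftrightarrow> X = Y"
  using elts_set_of by metis

lemma opair_inject [simp]: "opair x y = opair x' y' \<longleftrightarrow> x = x' \<and> y = y'"
proof -
  have small_sing: "small {a :: 'a}" for a
    using small_pair[of a a] by simp
  have "opair x y = opair x' y' \<longleftrightarrow>
      {set_of {x}, set_of {x, y}} = {set_of {x'}, set_of {x', y'}}"
    unfolding opair_def by (rule set_of_inject) (rule small_pair)+
  then show ?thesis
    by (auto simp: doubleton_eq_iff set_of_inject small_sing small_pair)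
qed

lemma pfst_opair [simp]: "pfst (opair x y) = x"
  and psnd_opair [simp]: "psnd (opair x y) = y"
  by (auto simp: pfst_def psnd_def)


text \<open>
  All maps below are \<open>undefined\<close> outside their carriers, so that equality in HOL of categories,
  functors, transformations and diagrams is equality of the mathematical objects. This matters
  because diagrams are themselves objects, and morphisms of diagrams themselves arrows.
\<close>

record ('o, 'a) category =
  Obj :: "'o set"
  Arr :: "'a set"
  Dom :: "'a \<Rightarrow> 'o"
  Cod :: "'a \<Rightarrow> 'o"
  Ide :: "'o \<Rightarrow> 'a"
  Comp :: "'a \<Rightarrow> 'a \<Rightarrow> 'a"

definition Hom :: "('o, 'a) category \<Rightarrow> 'o \<Rightarrow> 'o \<Rightarrow> 'a set"
  where "Hom C x y = {f \<in> Arr C. Dom C f = x \<and> Cod C f = y}"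

locale is_category =
  fixes C :: "('o, 'a) category"
  assumes dom_cod: "f \<in> Arr C \<Longrightarrow> Dom C f \<in> Obj C \<and> Cod C f \<in> Obj C"
    and ide_hom: "x \<in> Obj C \<Longrightarrow> Ide C x \<in> Hom C x x"
    and comp_hom: "f \<in> Hom C x y \<Longrightarrow> g \<in> Hom C y z \<Longrightarrow> Comp C g f \<in> Hom C x z"
    and comp_ide: "f \<in> Hom C x y \<Longrightarrow> Comp C f (Ide C x) = f"
    and ide_comp: "f \<in> Hom C x y \<Longrightarrow> Comp C (Ide C y) f = f"
    and comp_assoc: "f \<in> Hom C w x \<Longrightarrow> g \<in> Hom C x y \<Longrightarrow> h \<in> Hom C y z \<Longrightarrow>
      Comp C h (Comp C g f) = Comp C (Comp C h g) f"
    and dom_ext: "Dom C \<in> extensional (Arr C)"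
    and cod_ext: "Cod C \<in> extensional (Arr C)"
    and ide_ext: "Ide C \<in> extensional (Obj C)"
    and comp_ext: "\<not> (f \<in> Arr C \<and> g \<in> Arr C \<and> Cod C f = Dom C g) \<Longrightarrow> Comp C g f = undefined"

definition small_category :: "('u::universe, 'u) category \<Rightarrow> bool"
  where "small_category C \<longleftrightarrow> is_category C \<and> small (Obj C) \<and> small (Arr C)"

definition locally_small :: "('o, 'u::universe) category \<Rightarrow> bool"
  where "locally_small C \<longleftrightarrow> (\<forall>x\<in>Obj C. \<forall>y\<in>Obj C. small (Hom C x y))"

definition iso_in :: "('o, 'a) category \<Rightarrow> 'a \<Rightarrow> bool"
  where "iso_in C f \<longleftrightarrow> f \<in> Arr C \<and> (\<exists>g\<in>Hom C (Cod C f) (Dom C f).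
    Comp C g f = Ide C (Dom C f) \<and> Comp C f g = Ide C (Cod C f))"

record ('o, 'a, 'p, 'b) cfunctor =
  FOb :: "'o \<Rightarrow> 'p"
  FAr :: "'a \<Rightarrow> 'b"

locale is_functor =
  fixes C :: "('o, 'a) category" and D :: "('p, 'b) category" and F :: "('o, 'a, 'p, 'b) cfunctor"
  assumes source: "is_category C"
    and target: "is_category D"
    and obj: "x \<in> Obj C \<Longrightarrow> FOb F x \<in> Obj D"
    and arr: "f \<in> Hom C x y \<Longrightarrow> FAr F f \<in> Hom D (FOb F x) (FOb F y)"
    and ide: "x \<in> Obj C \<Longrightarrow> FAr F (Ide C x) = Ide D (FOb F x)"
    and comp: "f \<in> Hom C x y \<Longrightarrow> g \<in> Hom C y z \<Longrightarrow>
      FAr F (Comp C g f) = Comp D (FAr F g) (FAr F f)"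
    and obj_ext: "FOb F \<in> extensional (Obj C)"
    and arr_ext: "FAr F \<in> extensional (Arr C)"

definition id_functor :: "('o, 'a) category \<Rightarrow> ('o, 'a, 'o, 'a) cfunctor"
  where "id_functor C = \<lparr>FOb = (\<lambda>x\<in>Obj C. x), FAr = (\<lambda>f\<in>Arr C. f)\<rparr>"

text \<open>In \<open>fcomp C G F\<close> the argument \<open>C\<close> is the domain of \<open>F\<close>.\<close>

definition fcomp :: "('o, 'a) category \<Rightarrow> ('p, 'b, 'q, 'c) cfunctor \<Rightarrow> ('o, 'a, 'p, 'b) cfunctor
    \<Rightarrow> ('o, 'a, 'q, 'c) cfunctor"
  where "fcomp C G F =
    \<lparr>FOb = compose (Obj C) (FOb G) (FOb F), FAr = compose (Arr C) (FAr G) (FAr F)\<rparr>"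

locale nat_trans =
  fixes C :: "('o, 'a) category" and D :: "('p, 'b) category"
    and F G :: "('o, 'a, 'p, 'b) cfunctor" and \<alpha> :: "'o \<Rightarrow> 'b"
  assumes dom_functor: "is_functor C D F"
    and cod_functor: "is_functor C D G"
    and component: "x \<in> Obj C \<Longrightarrow> \<alpha> x \<in> Hom D (FOb F x) (FOb G x)"
    and natural: "f \<in> Hom C x y \<Longrightarrow> Comp D (\<alpha> y) (FAr F f) = Comp D (FAr G f) (\<alpha> x)"
    and component_ext: "\<alpha> \<in> extensional (Obj C)"

definition nat_iso :: "('o, 'a) category \<Rightarrow> ('p, 'b) category \<Rightarrow> ('o, 'a, 'p, 'b) cfunctor
    \<Rightarrow> ('o, 'a, 'p, 'b) cfunctor \<Rightarrow> ('o \<Rightarrow> 'b) \<Rightarrow> bool"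
  where "nat_iso C D F G \<alpha> \<longleftrightarrow> nat_trans C D F G \<alpha> \<and> (\<forall>x\<in>Obj C. iso_in D (\<alpha> x))"

text \<open>
  Vertical composite \<open>\<beta> \<circ> \<alpha>\<close> and whiskerings \<open>H \<alpha>\<close> and \<open>\<alpha> F\<close>; in each case \<open>C\<close> is the category
  on whose objects the resulting transformation is indexed.
\<close>

definition vcomp :: "('o, 'a) category \<Rightarrow> ('p, 'b) category \<Rightarrow> ('o \<Rightarrow> 'b) \<Rightarrow> ('o \<Rightarrow> 'b) \<Rightarrow> 'o \<Rightarrow> 'b"
  where "vcomp C D \<beta> \<alpha> = (\<lambda>x\<in>Obj C. Comp D (\<beta> x) (\<alpha> x))"

definition whisker_left :: "('o, 'a) category \<Rightarrow> ('p, 'b, 'q, 'c) cfunctor \<Rightarrow> ('o \<Rightarrow> 'b) \<Rightarrow> 'o \<Rightarrow> 'c"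
  where "whisker_left C H \<alpha> = (\<lambda>x\<in>Obj C. FAr H (\<alpha> x))"

definition whisker_right :: "('o, 'a) category \<Rightarrow> ('p \<Rightarrow> 'c) \<Rightarrow> ('o, 'a, 'p, 'b) cfunctor \<Rightarrow> 'o \<Rightarrow> 'c"
  where "whisker_right C \<alpha> F = (\<lambda>x\<in>Obj C. \<alpha> (FOb F x))"


record ('u, 'o, 'a) diagram =
  Shape :: "('u, 'u) category"
  Fun :: "('u, 'u, 'o, 'a) cfunctor"

text \<open>A morphism \<open>(R, \<rho>)\<close> is stored together with its source and target.\<close>

record ('u, 'o, 'a) diagram_mor =
  Src :: "('u, 'o, 'a) diagram"
  Tgt :: "('u, 'o, 'a) diagram"
  MFun :: "('u, 'u, 'u, 'u) cfunctor"
  MTrans :: "'u \<Rightarrow> 'a"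

definition is_diagram :: "('o, 'a) category \<Rightarrow> ('u::universe, 'o, 'a) diagram \<Rightarrow> bool"
  where "is_diagram C D \<longleftrightarrow> small_category (Shape D) \<and> is_functor (Shape D) C (Fun D)"

definition is_diagram_mor :: "('o, 'a) category \<Rightarrow> ('u::universe, 'o, 'a) diagram_mor \<Rightarrow> bool"
  where "is_diagram_mor C m \<longleftrightarrow> is_diagram C (Src m) \<and> is_diagram C (Tgt m) \<and>
    is_functor (Shape (Src m)) (Shape (Tgt m)) (MFun m) \<and>
    nat_trans (Shape (Src m)) C
      (Fun (Src m)) (fcomp (Shape (Src m)) (Fun (Tgt m)) (MFun m)) (MTrans m)"

definition Diag :: "('o, 'a) category
    \<Rightarrow> (('u::universe, 'o, 'a) diagram, ('u, 'o, 'a) diagram_mor) category"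
  where "Diag C =
    \<lparr>Obj = {D. is_diagram C D},
     Arr = {m. is_diagram_mor C m},
     Dom = (\<lambda>m\<in>{m. is_diagram_mor C m}. Src m),
     Cod = (\<lambda>m\<in>{m. is_diagram_mor C m}. Tgt m),
     Ide = (\<lambda>D\<in>{D. is_diagram C D}.
       \<lparr>Src = D, Tgt = D, MFun = id_functor (Shape D),
        MTrans = (\<lambda>x\<in>Obj (Shape D). Ide C (FOb (Fun D) x))\<rparr>),
     Comp = (\<lambda>n m.
       if is_diagram_mor C m \<and> is_diagram_mor C n \<and> Tgt m = Src n then
         \<lparr>Src = Src m, Tgt = Tgt n, MFun = fcomp (Shape (Src m)) (MFun n) (MFun m),
          MTrans = (\<lambda>x\<in>Obj (Shape (Src m)). Comp C (MTrans n (FOb (MFun m) x)) (MTrans m x))\<rparr>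
       else undefined)\<rparr>"

text \<open>\<open>push C F\<close> is \<open>F\<^sub>*\<close> and \<open>push_nt C F G \<alpha>\<close> is \<open>\<alpha>\<^sub>*\<close>, where \<open>F\<close>, \<open>G\<close> have domain \<open>C\<close>.\<close>

definition push_diagram :: "('o, 'a, 'p, 'b) cfunctor \<Rightarrow> ('u, 'o, 'a) diagram \<Rightarrow> ('u, 'p, 'b) diagram"
  where "push_diagram F D = \<lparr>Shape = Shape D, Fun = fcomp (Shape D) F (Fun D)\<rparr>"

definition push :: "('o, 'a) category \<Rightarrow> ('o, 'a, 'p, 'b) cfunctor
    \<Rightarrow> (('u::universe, 'o, 'a) diagram, ('u, 'o, 'a) diagram_mor,
        ('u, 'p, 'b) diagram, ('u, 'p, 'b) diagram_mor) cfunctor"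
  where "push C F =
    \<lparr>FOb = (\<lambda>D\<in>Obj (Diag C). push_diagram F D),
     FAr = (\<lambda>m\<in>Arr (Diag C).
       \<lparr>Src = push_diagram F (Src m), Tgt = push_diagram F (Tgt m), MFun = MFun m,
        MTrans = whisker_left (Shape (Src m)) F (MTrans m)\<rparr>)\<rparr>"

definition push_nt :: "('o, 'a) category \<Rightarrow> ('o, 'a, 'p, 'b) cfunctor \<Rightarrow> ('o, 'a, 'p, 'b) cfunctor
    \<Rightarrow> ('o \<Rightarrow> 'b) \<Rightarrow> ('u::universe, 'o, 'a) diagram \<Rightarrow> ('u, 'p, 'b) diagram_mor"
  where "push_nt C F G \<alpha> = (\<lambda>D\<in>Obj (Diag C).
    \<lparr>Src = push_diagram F D, Tgt = push_diagram G D, MFun = id_functor (Shape D),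
     MTrans = whisker_right (Shape D) \<alpha> (Fun D)\<rparr>)"


text \<open>The terminal category; the empty set is used both for \<open>\<bullet>\<close> and for its identity.\<close>

definition pt :: "'u::universe"
  where "pt = set_of {}"

definition one :: "('u::universe, 'u) category"
  where "one = \<lparr>Obj = {pt}, Arr = {pt}, Dom = (\<lambda>f\<in>{pt}. pt), Cod = (\<lambda>f\<in>{pt}. pt),
    Ide = (\<lambda>x\<in>{pt}. pt), Comp = (\<lambda>g f. if g = pt \<and> f = pt then pt else undefined)\<rparr>"

definition point :: "('o, 'a) category \<Rightarrow> 'o \<Rightarrow> ('u::universe, 'o, 'a) diagram"
  where "point C x = \<lparr>Shape = one, Fun = \<lparr>FOb = (\<lambda>_\<in>{pt}. x), FAr = (\<lambda>_\<in>{pt}. Ide C x)\<rparr>\<rparr>"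

definition eta :: "('o, 'a) category
    \<Rightarrow> ('o, 'a, ('u::universe, 'o, 'a) diagram, ('u, 'o, 'a) diagram_mor) cfunctor"
  where "eta C =
    \<lparr>FOb = (\<lambda>x\<in>Obj C. point C x),
     FAr = (\<lambda>f\<in>Arr C. \<lparr>Src = point C (Dom C f), Tgt = point C (Cod C f),
       MFun = id_functor one, MTrans = (\<lambda>_\<in>{pt}. f)\<rparr>)\<rparr>"

text \<open>
  Grothendieck construction of \<open>D\<^sub>0\<close> for a diagram \<open>D\<close> in \<open>Diag C\<close>. An arrow
  \<open>(j, f) : (J, X) \<rightarrow> (J', X')\<close> is not determined by the pair \<open>(j, f)\<close>, since \<open>f\<close> only
  determines \<open>D\<^sub>0j(X)\<close>; it is therefore encoded as the triple \<open>(X, j, f)\<close>.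
\<close>

definition triple :: "'u::universe \<Rightarrow> 'u \<Rightarrow> 'u \<Rightarrow> 'u"
  where "triple x j f = opair x (opair j f)"

definition tr_src :: "'u::universe \<Rightarrow> 'u"
  where "tr_src q = pfst q"

definition tr_base :: "'u::universe \<Rightarrow> 'u"
  where "tr_base q = pfst (psnd q)"

definition tr_fib :: "'u::universe \<Rightarrow> 'u"
  where "tr_fib q = psnd (psnd q)"

text \<open>\<open>fibre D J = D\<^sub>0J\<close>, \<open>transport D j = D\<^sub>0j\<close>, \<open>fdiag D J = D\<^sub>1J\<close>, \<open>ftrans D j = D\<^sub>1j\<close>.\<close>

type_synonym ('u, 'o, 'a) diagram2 =
  "('u, ('u, 'o, 'a) diagram, ('u, 'o, 'a) diagram_mor) diagram"

definition fibre :: "('u, 'o, 'a) diagram2 \<Rightarrow> 'u \<Rightarrow> ('u, 'u) category"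
  where "fibre D x = Shape (FOb (Fun D) x)"

definition fdiag :: "('u, 'o, 'a) diagram2 \<Rightarrow> 'u \<Rightarrow> ('u, 'u, 'o, 'a) cfunctor"
  where "fdiag D x = Fun (FOb (Fun D) x)"

definition transport :: "('u, 'o, 'a) diagram2 \<Rightarrow> 'u \<Rightarrow> ('u, 'u, 'u, 'u) cfunctor"
  where "transport D j = MFun (FAr (Fun D) j)"

definition ftrans :: "('u, 'o, 'a) diagram2 \<Rightarrow> 'u \<Rightarrow> 'u \<Rightarrow> 'a"
  where "ftrans D j = MTrans (FAr (Fun D) j)"

definition groth_obj :: "('u::universe, 'o, 'a) diagram2 \<Rightarrow> 'u set"
  where "groth_obj D = {opair x y | x y. x \<in> Obj (Shape D) \<and> y \<in> Obj (fibre D x)}"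

definition groth_arr :: "('u::universe, 'o, 'a) diagram2 \<Rightarrow> 'u set"
  where "groth_arr D = {triple y j f | y j f.
    j \<in> Arr (Shape D) \<and> y \<in> Obj (fibre D (Dom (Shape D) j)) \<and>
    f \<in> Arr (fibre D (Cod (Shape D) j)) \<and>
    Dom (fibre D (Cod (Shape D) j)) f = FOb (transport D j) y}"

definition groth_dom :: "('u::universe, 'o, 'a) diagram2 \<Rightarrow> 'u \<Rightarrow> 'u"
  where "groth_dom D = (\<lambda>q\<in>groth_arr D. opair (Dom (Shape D) (tr_base q)) (tr_src q))"

definition groth_cod :: "('u::universe, 'o, 'a) diagram2 \<Rightarrow> 'u \<Rightarrow> 'u"
  where "groth_cod D = (\<lambda>q\<in>groth_arr D. opair (Cod (Shape D) (tr_base q))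
    (Cod (fibre D (Cod (Shape D) (tr_base q))) (tr_fib q)))"

definition groth :: "('u::universe, 'o, 'a) diagram2 \<Rightarrow> ('u, 'u) category"
  where "groth D =
    \<lparr>Obj = groth_obj D,
     Arr = groth_arr D,
     Dom = groth_dom D,
     Cod = groth_cod D,
     Ide = (\<lambda>p\<in>groth_obj D.
       triple (psnd p) (Ide (Shape D) (pfst p)) (Ide (fibre D (pfst p)) (psnd p))),
     Comp = (\<lambda>r q.
       if q \<in> groth_arr D \<and> r \<in> groth_arr D \<and> groth_cod D q = groth_dom D r then
         triple (tr_src q) (Comp (Shape D) (tr_base r) (tr_base q))
           (Comp (fibre D (Cod (Shape D) (tr_base r)))
             (tr_fib r) (FAr (transport D (tr_base r)) (tr_fib q)))
       else undefined)\<rparr>"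

definition mu_obj :: "('o, 'a) category \<Rightarrow> ('u::universe, 'o, 'a) diagram2 \<Rightarrow> ('u, 'o, 'a) diagram"
  where "mu_obj C D =
    \<lparr>Shape = groth D,
     Fun =
       \<lparr>FOb = (\<lambda>p\<in>groth_obj D. FOb (fdiag D (pfst p)) (psnd p)),
        FAr = (\<lambda>q\<in>groth_arr D. Comp C
          (FAr (fdiag D (Cod (Shape D) (tr_base q))) (tr_fib q))
          (ftrans D (tr_base q) (tr_src q)))\<rparr>\<rparr>"

definition mu :: "('o, 'a) category
    \<Rightarrow> (('u::universe, 'o, 'a) diagram2,
        ('u, ('u, 'o, 'a) diagram, ('u, 'o, 'a) diagram_mor) diagram_mor,
        ('u, 'o, 'a) diagram, ('u, 'o, 'a) diagram_mor) cfunctor"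
  where "mu C =
    \<lparr>FOb = (\<lambda>D\<in>Obj (Diag (Diag C)). mu_obj C D),
     FAr = (\<lambda>m\<in>Arr (Diag (Diag C)).
       let D = Src m; F = MFun m; \<phi>0 = (\<lambda>x. MFun (MTrans m x)); \<phi>1 = (\<lambda>x. MTrans (MTrans m x)) in
       \<lparr>Src = mu_obj C D, Tgt = mu_obj C (Tgt m),
        MFun =
          \<lparr>FOb = (\<lambda>p\<in>groth_obj D. opair (FOb F (pfst p)) (FOb (\<phi>0 (pfst p)) (psnd p))),
           FAr = (\<lambda>q\<in>groth_arr D. triple
             (FOb (\<phi>0 (Dom (Shape D) (tr_base q))) (tr_src q))
             (FAr F (tr_base q))
             (FAr (\<phi>0 (Cod (Shape D) (tr_base q))) (tr_fib q)))\<rparr>,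
        MTrans = (\<lambda>p\<in>groth_obj D. \<phi>1 (pfst p) (psnd p))\<rparr>)\<rparr>"

text \<open>
  \<open>r : id \<Rightarrow> \<mu> \<circ> \<eta>\<^sub>*\<close> and \<open>a : \<mu> \<circ> \<mu>\<^sub>* \<Rightarrow> \<mu> \<circ> \<mu>\<^sub>D\<^sub>i\<^sub>a\<^sub>g\<close>. Both commute strictly with the functors to
  \<open>C\<close>, so their second components are identities. On arrows, \<open>r\<close> sends \<open>f : X \<rightarrow> X'\<close> to
  \<open>(f, id\<^sub>\<bullet>) : (X, \<bullet>) \<rightarrow> (X', \<bullet>)\<close> and \<open>a\<close> sends \<open>(j, (k, l))\<close> to \<open>((j, k), l)\<close>.
\<close>

definition unitor_r :: "('o, 'a) category \<Rightarrow> ('u::universe, 'o, 'a) diagram \<Rightarrow> ('u, 'o, 'a) diagram_mor"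
  where "unitor_r C = (\<lambda>D\<in>Obj (Diag C).
    \<lparr>Src = D, Tgt = FOb (mu C) (FOb (push C (eta C)) D),
     MFun =
       \<lparr>FOb = (\<lambda>x\<in>Obj (Shape D). opair x pt),
        FAr = (\<lambda>f\<in>Arr (Shape D). triple pt f pt)\<rparr>,
     MTrans = (\<lambda>x\<in>Obj (Shape D). Ide C (FOb (Fun D) x))\<rparr>)"

definition assoc_a :: "('o, 'a) category
    \<Rightarrow> ('u::universe, ('u, 'o, 'a) diagram, ('u, 'o, 'a) diagram_mor) diagram2
    \<Rightarrow> ('u, 'o, 'a) diagram_mor"
  where "assoc_a C = (\<lambda>D\<in>Obj (Diag (Diag (Diag C))).
    let S = FOb (mu C) (FOb (push (Diag (Diag C)) (mu C)) D);
        T = FOb (mu C) (FOb (mu (Diag C)) D)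
    in
    \<lparr>Src = S, Tgt = T,
     MFun =
       \<lparr>FOb = (\<lambda>p\<in>Obj (Shape S). opair (opair (pfst p) (pfst (psnd p))) (psnd (psnd p))),
        FAr = (\<lambda>q\<in>Arr (Shape S).
          triple (psnd (tr_src q))
            (triple (pfst (tr_src q)) (tr_base q) (tr_base (tr_fib q)))
            (tr_fib (tr_fib q)))\<rparr>,
     MTrans = (\<lambda>p\<in>Obj (Shape S). Ide C (FOb (Fun S) p))\<rparr>)"


locale pseudoalgebra =
  fixes A :: "('u::universe, 'u) category"
    and e :: "(('u, 'u, 'u) diagram, ('u, 'u, 'u) diagram_mor, 'u, 'u) cfunctor"
    and \<iota> :: "'u \<Rightarrow> 'u"
    and \<gamma> :: "('u, 'u, 'u) diagram2 \<Rightarrow> 'u"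
  assumes category: "is_category A" "locally_small A"
    and functor_e: "is_functor (Diag A) A e"
    and iso_iota: "nat_iso A A (fcomp A e (eta A)) (id_functor A) \<iota>"
    and iso_gamma: "nat_iso (Diag (Diag A)) A
      (fcomp (Diag (Diag A)) e (push (Diag A) e)) (fcomp (Diag (Diag A)) e (mu A)) \<gamma>"
    and unit_law:
      "whisker_right (Diag A) \<gamma> (push A (eta A)) =
       vcomp (Diag A) A
         (whisker_left (Diag A) e (unitor_r A))
         (whisker_left (Diag A) e (push_nt A (fcomp A e (eta A)) (id_functor A) \<iota>))"
    and assoc_law:
      "vcomp (Diag (Diag (Diag A))) A
         (whisker_left (Diag (Diag (Diag A))) e (assoc_a A))
         (vcomp (Diag (Diag (Diag A))) A
           (whisker_right (Diag (Diag (Diag A))) \<gamma> (push (Diag (Diag A)) (mu A)))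
           (whisker_left (Diag (Diag (Diag A))) e
             (push_nt (Diag (Diag A))
               (fcomp (Diag (Diag A)) e (push (Diag A) e)) (fcomp (Diag (Diag A)) e (mu A)) \<gamma>))) =
       vcomp (Diag (Diag (Diag A))) A
         (whisker_right (Diag (Diag (Diag A))) \<gamma> (mu (Diag A)))
         (whisker_right (Diag (Diag (Diag A))) \<gamma> (push (Diag (Diag A)) (push (Diag A) e)))"


definition is_cocone :: "('o, 'a) category \<Rightarrow> ('u::universe, 'o, 'a) diagram \<Rightarrow> 'o \<Rightarrow> ('u \<Rightarrow> 'a) \<Rightarrow> bool"
  where "is_cocone C D x k \<longleftrightarrow> x \<in> Obj C \<and>
    (\<forall>J\<in>Obj (Shape D). k J \<in> Hom C (FOb (Fun D) J) x) \<and>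
    (\<forall>J J'. \<forall>j\<in>Hom (Shape D) J J'. Comp C (k J') (FAr (Fun D) j) = k J)"

definition is_colimit :: "('o, 'a) category \<Rightarrow> ('u::universe, 'o, 'a) diagram \<Rightarrow> 'o \<Rightarrow> ('u \<Rightarrow> 'a) \<Rightarrow> bool"
  where "is_colimit C D x k \<longleftrightarrow> is_cocone C D x k \<and>
    (\<forall>y l. is_cocone C D y l \<longrightarrow>
      (\<exists>!u. u \<in> Hom C x y \<and> (\<forall>J\<in>Obj (Shape D). Comp C u (k J) = l J)))"

definition cocomplete :: "('u::universe, 'u) category \<Rightarrow> bool"
  where "cocomplete C \<longleftrightarrow> is_category C \<and> locally_small C \<and>
    (\<forall>D :: ('u, 'u, 'u) diagram. is_diagram C D \<longrightarrow> (\<exists>x k. is_colimit C D x k))"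

definition colimit_choice :: "('o, 'a) category \<Rightarrow> (('u::universe, 'o, 'a) diagram \<Rightarrow> 'o)
    \<Rightarrow> (('u, 'o, 'a) diagram \<Rightarrow> 'u \<Rightarrow> 'a) \<Rightarrow> bool"
  where "colimit_choice C c h \<longleftrightarrow> (\<forall>D. is_diagram C D \<longrightarrow> is_colimit C D (c D) (h D))"

definition colimit_functor :: "('o, 'a) category \<Rightarrow> (('u::universe, 'o, 'a) diagram \<Rightarrow> 'o)
    \<Rightarrow> (('u, 'o, 'a) diagram \<Rightarrow> 'u \<Rightarrow> 'a)
    \<Rightarrow> (('u, 'o, 'a) diagram, ('u, 'o, 'a) diagram_mor, 'o, 'a) cfunctor"
  where "colimit_functor C c h =
    \<lparr>FOb = (\<lambda>D\<in>Obj (Diag C). c D),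
     FAr = (\<lambda>m\<in>Arr (Diag C). THE u. u \<in> Hom C (c (Src m)) (c (Tgt m)) \<and>
       (\<forall>J\<in>Obj (Shape (Src m)).
         Comp C u (h (Src m) J) = Comp C (h (Tgt m) (FOb (MFun m) J)) (MTrans m J)))\<rparr>"

end

theory Submission
  imports Defs
begin

text \<open>
  Take for \<open>A\<close> the category of sets and let \<open>e (J, D)\<close> be the disjoint union of the sets \<open>D j\<close> over
  the objects \<open>j\<close> of \<open>J\<close>, ignoring the arrows of \<open>J\<close>. Morphisms of diagrams act on disjoint unions,
  and since the objects of a Grothendieck construction are the pairs \<open>(j, x)\<close>, iterated disjoint
  unions are reassociated by \<open>(j, (x, a)) \<mapsto> ((j, x), a)\<close>; the coherence laws hold elementwise. This
  algebra does not compute colimits: the constant one-point diagram on the chaotic category with two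
  objects has a one-point colimit, but a two-point disjoint union.
\<close>

section \<open>Categories of diagrams\<close>

text \<open>Conceptually, \<open>e\<close> is the colimit of the diagram restricted to the discrete
  category on the objects of its shape. The obstacle is not the elementwise computation.
  \<open>coproduct_functor\<close> is given by its formula only on genuine morphisms of diagrams and
  is \<open>undefined\<close> elsewhere, while the coherence laws apply it to the unitor, the
  associator and the pushed forward isomorphisms. Each of these must first be shown to be a morphism
  of diagrams, and \<open>mu\<close> to be a functor. This is where the arrows of the shapes enter,
  and it is carried out over an arbitrary category \<open>C\<close>; only then does evaluation on
  elements become available. The refutation computes no colimit. It uses only the uniqueness half of
  the universal property, together with the equality of the two functors on a single object.\<close>

lemma Hom_iff: "f \<in> Hom C x y \<longleftrightarrow> f \<in> Arr C \<and> Dom C f = x \<and> Cod C f = y"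
  by (simp add: Hom_def)

context is_category
begin

lemma dom_obj [simp]: "f \<in> Arr C \<Longrightarrow> Dom C f \<in> Obj C"
  and cod_obj [simp]: "f \<in> Arr C \<Longrightarrow> Cod C f \<in> Obj C"
  using dom_cod by blast+

lemma ide_arr [simp]: "x \<in> Obj C \<Longrightarrow> Ide C x \<in> Arr C"
  and dom_ide [simp]: "x \<in> Obj C \<Longrightarrow> Dom C (Ide C x) = x"
  and cod_ide [simp]: "x \<in> Obj C \<Longrightarrow> Cod C (Ide C x) = x"
  using ide_hom by (auto simp: Hom_iff)

lemma comp_arr [simp]: "f \<in> Arr C \<Longrightarrow> g \<in> Arr C \<Longrightarrow> Cod C f = Dom C g \<Longrightarrow> Comp C g f \<in> Arr C"
  and dom_comp [simp]: "f \<in> Arr C \<Longrightarrow> g \<in> Arr C \<Longrightarrow> Cod C f = Dom C g \<Longrightarrow> Dom C (Comp C g f) = Dom C f"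
  and cod_comp [simp]: "f \<in> Arr C \<Longrightarrow> g \<in> Arr C \<Longrightarrow> Cod C f = Dom C g \<Longrightarrow> Cod C (Comp C g f) = Cod C g"
  using comp_hom[of f "Dom C f" "Cod C f" g "Cod C g"] by (auto simp: Hom_iff)

lemma comp_ide_right [simp]: "f \<in> Arr C \<Longrightarrow> x = Dom C f \<Longrightarrow> Comp C f (Ide C x) = f"
  and comp_ide_left [simp]: "f \<in> Arr C \<Longrightarrow> y = Cod C f \<Longrightarrow> Comp C (Ide C y) f = f"
  using comp_ide ide_comp by (auto simp: Hom_iff)

lemma comp_comp:
  "f \<in> Arr C \<Longrightarrow> g \<in> Arr C \<Longrightarrow> h \<in> Arr C \<Longrightarrow> Cod C f = Dom C g \<Longrightarrow> Cod C g = Dom C h \<Longrightarrow>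
    Comp C (Comp C h g) f = Comp C h (Comp C g f)"
  using comp_assoc[of f "Dom C f" "Cod C f" g "Cod C g" h "Cod C h"] by (auto simp: Hom_iff)

end

text \<open>Composability is phrased as an equation between \<open>Cod\<close> and
  \<open>Dom\<close> instead of membership in \<open>Hom\<close>, since arrows of
  \<open>Diag\<close> and of Grothendieck constructions come with computed endpoints. Among the
  premises, 5 to 7 are the unit and associativity laws and 11 is the convention that impossible
  composites are \<open>undefined\<close>.\<close>

lemma is_categoryI:
  assumes "\<And>f. f \<in> Arr C \<Longrightarrow> Dom C f \<in> Obj C" "\<And>f. f \<in> Arr C \<Longrightarrow> Cod C f \<in> Obj C"
    and "\<And>x. x \<in> Obj C \<Longrightarrow> Ide C x \<in> Arr C \<and> Dom C (Ide C x) = x \<and> Cod C (Ide C x) = x"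
    and "\<And>f g. f \<in> Arr C \<Longrightarrow> g \<in> Arr C \<Longrightarrow> Cod C f = Dom C g \<Longrightarrow>
      Comp C g f \<in> Arr C \<and> Dom C (Comp C g f) = Dom C f \<and> Cod C (Comp C g f) = Cod C g"
    and "\<And>f. f \<in> Arr C \<Longrightarrow> Comp C f (Ide C (Dom C f)) = f"
    and "\<And>f. f \<in> Arr C \<Longrightarrow> Comp C (Ide C (Cod C f)) f = f"
    and "\<And>f g h. f \<in> Arr C \<Longrightarrow> g \<in> Arr C \<Longrightarrow> h \<in> Arr C \<Longrightarrow> Cod C f = Dom C g \<Longrightarrow>
      Cod C g = Dom C h \<Longrightarrow> Comp C h (Comp C g f) = Comp C (Comp C h g) f"
    and "Dom C \<in> extensional (Arr C)" "Cod C \<in> extensional (Arr C)" "Ide C \<in> extensional (Obj C)"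
    and "\<And>f g. \<not> (f \<in> Arr C \<and> g \<in> Arr C \<and> Cod C f = Dom C g) \<Longrightarrow> Comp C g f = undefined"
  shows "is_category C"
  using assms by unfold_locales (auto simp: Hom_iff)

context is_functor
begin

sublocale C: is_category C by (rule source)
sublocale D: is_category D by (rule target)

lemma obj_in [simp]: "x \<in> Obj C \<Longrightarrow> FOb F x \<in> Obj D"
  by (rule obj)

lemma arr_in [simp]: "f \<in> Arr C \<Longrightarrow> FAr F f \<in> Arr D"
  and dom_arr [simp]: "f \<in> Arr C \<Longrightarrow> Dom D (FAr F f) = FOb F (Dom C f)"
  and cod_arr [simp]: "f \<in> Arr C \<Longrightarrow> Cod D (FAr F f) = FOb F (Cod C f)"
  using arr[of f "Dom C f" "Cod C f"] by (auto simp: Hom_iff)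

lemma arr_ide [simp]: "x \<in> Obj C \<Longrightarrow> FAr F (Ide C x) = Ide D (FOb F x)"
  by (rule ide)

lemma arr_comp [simp]: "f \<in> Arr C \<Longrightarrow> g \<in> Arr C \<Longrightarrow> Cod C f = Dom C g \<Longrightarrow>
    FAr F (Comp C g f) = Comp D (FAr F g) (FAr F f)"
  using comp by (auto simp: Hom_iff)

end

text \<open>Premise 3 concerns objects, 4 endpoints of arrows, 5 identities, 6 composites, and 7 and
  8 the values outside the carriers; the numbered cases in later functoriality proofs refer to this
  order.\<close>

lemma is_functorI:
  assumes "is_category C" "is_category D"
    and "\<And>x. x \<in> Obj C \<Longrightarrow> FOb F x \<in> Obj D"
    and "\<And>f. f \<in> Arr C \<Longrightarrow> FAr F f \<in> Arr D \<and> Dom D (FAr F f) = FOb F (Dom C f) \<and>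
      Cod D (FAr F f) = FOb F (Cod C f)"
    and "\<And>x. x \<in> Obj C \<Longrightarrow> FAr F (Ide C x) = Ide D (FOb F x)"
    and "\<And>f g. f \<in> Arr C \<Longrightarrow> g \<in> Arr C \<Longrightarrow> Cod C f = Dom C g \<Longrightarrow>
      FAr F (Comp C g f) = Comp D (FAr F g) (FAr F f)"
    and "FOb F \<in> extensional (Obj C)" "FAr F \<in> extensional (Arr C)"
  shows "is_functor C D F"
  using assms by (auto simp: is_functor_def Hom_iff)

lemma FOb_id_functor [simp]: "x \<in> Obj C \<Longrightarrow> FOb (id_functor C) x = x"
  and FAr_id_functor [simp]: "f \<in> Arr C \<Longrightarrow> FAr (id_functor C) f = f"
  by (simp_all add: id_functor_def)

lemma FOb_fcomp [simp]: "x \<in> Obj C \<Longrightarrow> FOb (fcomp C G F) x = FOb G (FOb F x)"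
  and FAr_fcomp [simp]: "f \<in> Arr C \<Longrightarrow> FAr (fcomp C G F) f = FAr G (FAr F f)"
  by (simp_all add: fcomp_def compose_def)

lemma fcomp_ext [simp]: "FOb (fcomp C G F) \<in> extensional (Obj C)" "FAr (fcomp C G F) \<in> extensional (Arr C)"
  by (simp_all add: fcomp_def)

lemma id_functor_ext [simp]: "FOb (id_functor C) \<in> extensional (Obj C)" "FAr (id_functor C) \<in> extensional (Arr C)"
  by (simp_all add: id_functor_def)

text \<open>Extensionality turns agreement on the carriers into equality of records. Strict equality
  of functors is needed because functors are parts of diagrams, and diagrams are objects to be
  compared.\<close>

lemma cfunctor_eqI:
  fixes F G :: "('o, 'a, 'p, 'b) cfunctor"
  assumes "FOb F \<in> extensional X" "FOb G \<in> extensional X"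
    and "FAr F \<in> extensional Y" "FAr G \<in> extensional Y"
    and "\<And>x. x \<in> X \<Longrightarrow> FOb F x = FOb G x" "\<And>f. f \<in> Y \<Longrightarrow> FAr F f = FAr G f"
  shows "F = G"
  by (rule cfunctor.equality) (use assms in \<open>auto intro: extensionalityI\<close>)

lemma is_functor_id [intro]: "is_category C \<Longrightarrow> is_functor C C (id_functor C)"
proof -
  assume "is_category C"
  then interpret is_category C .
  show ?thesis by (rule is_functorI) (auto intro: is_category_axioms)
qed

lemma is_functor_fcomp [intro]:
  assumes "is_functor C D F" "is_functor D E G"
  shows "is_functor C E (fcomp C G F)"
proof -
  interpret F: is_functor C D F by fact
  interpret G: is_functor D E G by fact
  show ?thesis by (rule is_functorI) (auto intro: F.source G.target)
qed

lemma fcomp_id_left [simp]: "is_functor C D F \<Longrightarrow> fcomp C (id_functor D) F = F"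
proof -
  assume "is_functor C D F"
  then interpret is_functor C D F .
  show ?thesis by (rule cfunctor_eqI) (auto intro: obj_ext arr_ext)
qed

lemma fcomp_fcomp:
  assumes "is_functor C D F"
  shows "fcomp C (fcomp D H G) F = fcomp C H (fcomp C G F)"
proof -
  interpret is_functor C D F by fact
  show ?thesis by (rule cfunctor_eqI[where X = "Obj C" and Y = "Arr C"]) auto
qed

context nat_trans
begin

sublocale F: is_functor C D F by (rule dom_functor)
sublocale G: is_functor C D G by (rule cod_functor)

lemma comp_in [simp]: "x \<in> Obj C \<Longrightarrow> \<alpha> x \<in> Arr D"
  and dom_comp [simp]: "x \<in> Obj C \<Longrightarrow> Dom D (\<alpha> x) = FOb F x"
  and cod_comp [simp]: "x \<in> Obj C \<Longrightarrow> Cod D (\<alpha> x) = FOb G x"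
  using component[of x] by (auto simp: Hom_iff)

lemma naturality: "f \<in> Arr C \<Longrightarrow> Comp D (\<alpha> (Cod C f)) (FAr F f) = Comp D (FAr G f) (\<alpha> (Dom C f))"
  using natural by (auto simp: Hom_iff)

end

lemma nat_transI:
  assumes "is_functor C D F" "is_functor C D G"
    and "\<And>x. x \<in> Obj C \<Longrightarrow> \<alpha> x \<in> Arr D \<and> Dom D (\<alpha> x) = FOb F x \<and> Cod D (\<alpha> x) = FOb G x"
    and "\<And>f. f \<in> Arr C \<Longrightarrow> Comp D (\<alpha> (Cod C f)) (FAr F f) = Comp D (FAr G f) (\<alpha> (Dom C f))"
    and "\<alpha> \<in> extensional (Obj C)"
  shows "nat_trans C D F G \<alpha>"
  using assms by (auto simp: nat_trans_def Hom_iff)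

section \<open>Diagrams, their morphisms, and the category \<open>Diag C\<close>\<close>

lemma Obj_Diag: "D \<in> Obj (Diag C) \<longleftrightarrow> is_diagram C D"
  and Arr_Diag: "m \<in> Arr (Diag C) \<longleftrightarrow> is_diagram_mor C m"
  and Dom_Diag [simp]: "is_diagram_mor C m \<Longrightarrow> Dom (Diag C) m = Src m"
  and Cod_Diag [simp]: "is_diagram_mor C m \<Longrightarrow> Cod (Diag C) m = Tgt m"
  by (simp_all add: Diag_def)

lemma Ide_Diag [simp]:
  assumes "is_diagram C D"
  shows "Src (Ide (Diag C) D) = D" "Tgt (Ide (Diag C) D) = D"
    "MFun (Ide (Diag C) D) = id_functor (Shape D)"
    "MTrans (Ide (Diag C) D) = (\<lambda>x\<in>Obj (Shape D). Ide C (FOb (Fun D) x))"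
  using assms by (simp_all add: Diag_def)

lemma Comp_Diag [simp]:
  assumes "is_diagram_mor C m" "is_diagram_mor C n" "Tgt m = Src n"
  shows "Src (Comp (Diag C) n m) = Src m" "Tgt (Comp (Diag C) n m) = Tgt n"
    "MFun (Comp (Diag C) n m) = fcomp (Shape (Src m)) (MFun n) (MFun m)"
    "MTrans (Comp (Diag C) n m) =
      (\<lambda>x\<in>Obj (Shape (Src m)). Comp C (MTrans n (FOb (MFun m) x)) (MTrans m x))"
  using assms by (simp_all add: Diag_def)

lemma is_diagramI: "small_category (Shape D) \<Longrightarrow> is_functor (Shape D) C (Fun D) \<Longrightarrow> is_diagram C D"
  by (simp add: is_diagram_def)

lemma diagram_functor: "is_diagram C D \<Longrightarrow> is_functor (Shape D) C (Fun D)"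
  by (simp add: is_diagram_def)

lemma diagram_small: "is_diagram C D \<Longrightarrow> small_category (Shape D)"
  by (simp add: is_diagram_def)

lemma diagram_category: "is_diagram C D \<Longrightarrow> is_category (Shape D)"
  by (simp add: is_diagram_def small_category_def)

lemma diagram_mor_src: "is_diagram_mor C m \<Longrightarrow> is_diagram C (Src m)"
  and diagram_mor_tgt: "is_diagram_mor C m \<Longrightarrow> is_diagram C (Tgt m)"
  and diagram_mor_functor: "is_diagram_mor C m \<Longrightarrow> is_functor (Shape (Src m)) (Shape (Tgt m)) (MFun m)"
  and diagram_mor_nat: "is_diagram_mor C m \<Longrightarrow> nat_trans (Shape (Src m)) C
      (Fun (Src m)) (fcomp (Shape (Src m)) (Fun (Tgt m)) (MFun m)) (MTrans m)"
  by (simp_all add: is_diagram_mor_def)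

locale diagram_morphism =
  fixes C :: "('o, 'a) category" and m :: "('u::universe, 'o, 'a) diagram_mor"
  assumes mor: "is_diagram_mor C m"
begin

sublocale R: is_functor "Shape (Src m)" "Shape (Tgt m)" "MFun m"
  by (rule diagram_mor_functor[OF mor])

sublocale N: nat_trans "Shape (Src m)" C
      "Fun (Src m)" "fcomp (Shape (Src m)) (Fun (Tgt m)) (MFun m)" "MTrans m"
  by (rule diagram_mor_nat[OF mor])

sublocale T: is_functor "Shape (Tgt m)" C "Fun (Tgt m)"
  using diagram_functor[OF diagram_mor_tgt[OF mor]] .

end

lemma is_diagram_morI:
  assumes "is_diagram C (Src m)" "is_diagram C (Tgt m)"
    and "is_functor (Shape (Src m)) (Shape (Tgt m)) (MFun m)"
    and "\<And>x. x \<in> Obj (Shape (Src m)) \<Longrightarrow> MTrans m x \<in> Arr C \<and>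
      Dom C (MTrans m x) = FOb (Fun (Src m)) x \<and> Cod C (MTrans m x) = FOb (Fun (Tgt m)) (FOb (MFun m) x)"
    and "\<And>f. f \<in> Arr (Shape (Src m)) \<Longrightarrow>
      Comp C (MTrans m (Cod (Shape (Src m)) f)) (FAr (Fun (Src m)) f) =
      Comp C (FAr (Fun (Tgt m)) (FAr (MFun m) f)) (MTrans m (Dom (Shape (Src m)) f))"
    and "MTrans m \<in> extensional (Obj (Shape (Src m)))"
  shows "is_diagram_mor C m"
  unfolding is_diagram_mor_def
proof (intro conjI)
  show "nat_trans (Shape (Src m)) C
     (Fun (Src m)) (fcomp (Shape (Src m)) (Fun (Tgt m)) (MFun m)) (MTrans m)"
    by (rule nat_transI) (use assms diagram_functor[OF assms(1)] diagram_functor[OF assms(2)] in auto)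
qed (use assms in auto)

text \<open>All maps stored in a morphism of diagrams are extensional over the source shape, so
  agreement there suffices. Unit laws, associativity and functoriality into a category of diagrams
  are all reduced to this pointwise comparison.\<close>

lemma diagram_mor_eqI:
  fixes m n :: "('u::universe, 'o, 'a) diagram_mor"
  assumes "is_diagram_mor C m" "is_diagram_mor C n" "Src m = Src n" "Tgt m = Tgt n"
    and "\<And>x. x \<in> Obj (Shape (Src m)) \<Longrightarrow> FOb (MFun m) x = FOb (MFun n) x"
    and "\<And>f. f \<in> Arr (Shape (Src m)) \<Longrightarrow> FAr (MFun m) f = FAr (MFun n) f"
    and "\<And>x. x \<in> Obj (Shape (Src m)) \<Longrightarrow> MTrans m x = MTrans n x"
  shows "m = n"
proof -
  interpret m: diagram_morphism C m by unfold_locales fact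
  interpret n: diagram_morphism C n by unfold_locales fact
  have "MFun m = MFun n"
    using assms m.R.obj_ext n.R.obj_ext m.R.arr_ext n.R.arr_ext by (intro cfunctor_eqI) auto
  moreover have "MTrans m = MTrans n"
    by (rule extensionalityI[OF m.N.component_ext]) (use assms n.N.component_ext in auto)
  ultimately show ?thesis using assms by (intro diagram_mor.equality) auto
qed

lemma is_diagram_mor_ide:
  assumes "is_category C" "is_diagram C D"
  shows "is_diagram_mor C (Ide (Diag C) D)"
proof -
  interpret is_functor "Shape D" C "Fun D" using assms by (simp add: diagram_functor)
  show ?thesis
    by (rule is_diagram_morI) (use assms in \<open>auto intro: diagram_category\<close>)
qed

lemma is_diagram_mor_comp:
  assumes "is_category C" "is_diagram_mor C m" "is_diagram_mor C n" "Tgt m = Src n"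
  shows "is_diagram_mor C (Comp (Diag C) n m)"
proof -
  interpret is_category C by fact
  interpret m: diagram_morphism C m by unfold_locales fact
  interpret n: diagram_morphism C n by unfold_locales fact
  have eq: "Src n = Tgt m" using assms(4) by simp
  have "is_functor (Shape (Src m)) (Shape (Tgt n)) (fcomp (Shape (Src m)) (MFun n) (MFun m))"
    using m.R.is_functor_axioms n.R.is_functor_axioms eq by auto
  moreover have "Comp C (Comp C (MTrans n (FOb (MFun m) (Cod (Shape (Src m)) f))) (MTrans m (Cod (Shape (Src m)) f)))
       (FAr (Fun (Src m)) f) =
      Comp C (FAr (Fun (Tgt n)) (FAr (MFun n) (FAr (MFun m) f)))
       (Comp C (MTrans n (FOb (MFun m) (Dom (Shape (Src m)) f))) (MTrans m (Dom (Shape (Src m)) f)))"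
    if f: "f \<in> Arr (Shape (Src m))" for f
  proof -
    have 1: "Comp C (MTrans n (FOb (MFun m) (Cod (Shape (Src m)) f))) (FAr (Fun (Tgt m)) (FAr (MFun m) f))
      = Comp C (FAr (Fun (Tgt n)) (FAr (MFun n) (FAr (MFun m) f))) (MTrans n (FOb (MFun m) (Dom (Shape (Src m)) f)))"
      using n.N.naturality[of "FAr (MFun m) f"] f by (simp add: eq)
    have 2: "Comp C (MTrans m (Cod (Shape (Src m)) f)) (FAr (Fun (Src m)) f) =
      Comp C (FAr (Fun (Tgt m)) (FAr (MFun m) f)) (MTrans m (Dom (Shape (Src m)) f))"
      using m.N.naturality[of f] f by simp
    \<comment> \<open>Pasting of two squares: \<open>2\<close> is naturality of \<open>m\<close> at
      \<open>f\<close>, and \<open>1\<close> is naturality of \<open>n\<close> at the image of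
      \<open>f\<close>. Bracketing to the right exposes \<open>2\<close>, bracketing to the left
      then exposes \<open>1\<close>.\<close>
    show ?thesis using f 1 2
      by (simp add: comp_comp eq) (simp add: comp_comp[symmetric] eq)
  qed
  ultimately show ?thesis
    by (intro is_diagram_morI) (use assms(2,3) in \<open>auto simp: diagram_mor_src diagram_mor_tgt eq\<close>)
qed

lemma is_category_Diag:
  assumes "is_category C"
  shows "is_category (Diag C :: (('u::universe, 'o, 'a) diagram, ('u, 'o, 'a) diagram_mor) category)"
proof -
  interpret is_category C by fact
  note mors = is_diagram_mor_ide is_diagram_mor_comp diagram_mor_src diagram_mor_tgt
  show ?thesis
  proof (rule is_categoryI, goal_cases)
    case (5 m)
    then have m: "is_diagram_mor C m" by (simp add: Arr_Diag)
    then interpret m: diagram_morphism C m by unfold_locales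
    from m assms show ?case by (intro diagram_mor_eqI[of C]) (auto simp: mors)
  next
    case (6 m)
    then have m: "is_diagram_mor C m" by (simp add: Arr_Diag)
    then interpret m: diagram_morphism C m by unfold_locales
    from m assms show ?case by (intro diagram_mor_eqI[of C]) (auto simp: mors)
  next
    case (7 m n k)
    then have m: "is_diagram_mor C m" "is_diagram_mor C n" "is_diagram_mor C k"
      and eq: "Src n = Tgt m" "Src k = Tgt n" by (simp_all add: Arr_Diag)
    interpret m: diagram_morphism C m by unfold_locales fact
    interpret n: diagram_morphism C n by unfold_locales fact
    interpret k: diagram_morphism C k by unfold_locales fact
    show ?case using m eq assms by (intro diagram_mor_eqI[of C]) (auto simp: mors comp_comp)
  next
    case (11 m n)
    then show ?case by (auto simp: Arr_Diag) (auto simp: Diag_def)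
  qed (use assms in \<open>auto simp: Obj_Diag Arr_Diag mors\<close>, auto simp: Diag_def)
qed

section \<open>Pushing diagrams forward along functors and transformations\<close>

lemma push_diagram_sel [simp]:
  "Shape (push_diagram F D) = Shape D"
  "Fun (push_diagram F D) = fcomp (Shape D) F (Fun D)"
  by (simp_all add: push_diagram_def)

lemma push_sel [simp]:
  "is_diagram C D \<Longrightarrow> FOb (push C F) D = push_diagram F D"
  "is_diagram_mor C m \<Longrightarrow> Src (FAr (push C F) m) = push_diagram F (Src m)"
  "is_diagram_mor C m \<Longrightarrow> Tgt (FAr (push C F) m) = push_diagram F (Tgt m)"
  "is_diagram_mor C m \<Longrightarrow> MFun (FAr (push C F) m) = MFun m"
  "is_diagram_mor C m \<Longrightarrow> x \<in> Obj (Shape (Src m)) \<Longrightarrow> MTrans (FAr (push C F) m) x = FAr F (MTrans m x)"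
  by (simp_all add: push_def Obj_Diag Arr_Diag whisker_left_def)

lemma is_diagram_push:
  assumes "is_functor C E F" "is_diagram C D"
  shows "is_diagram E (push_diagram F D)"
  using assms by (auto simp: is_diagram_def)

lemma is_diagram_mor_push:
  assumes "is_functor C E F" "is_diagram_mor C m"
  shows "is_diagram_mor E (FAr (push C F) m)"
proof -
  interpret F: is_functor C E F by fact
  interpret m: diagram_morphism C m by unfold_locales fact
  have "MTrans (FAr (push C F) m) \<in> extensional (Obj (Shape (Src m)))"
    using assms by (simp add: push_def Arr_Diag whisker_left_def)
  with assms show ?thesis
    by (intro is_diagram_morI)
      (auto simp: is_diagram_push diagram_mor_src diagram_mor_tgt m.R.is_functor_axioms m.N.naturality
        simp flip: F.arr_comp)
qed

lemma is_functor_push: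
  assumes "is_functor C E F"
  shows "is_functor (Diag C) (Diag E)
    (push C F :: (('u::universe, _, _) diagram, _, _, _) cfunctor)"
proof -
  interpret F: is_functor C E F by fact
  note pd = is_diagram_push[OF assms] is_diagram_mor_push[OF assms]
  note mors = is_diagram_mor_ide is_diagram_mor_comp diagram_mor_src diagram_mor_tgt
  show ?thesis
  proof (rule is_functorI, goal_cases)
    case (5 D)
    then have D: "is_diagram C D" by (simp add: Obj_Diag)
    interpret D: is_functor "Shape D" C "Fun D" using D by (rule diagram_functor)
    show ?case by (rule diagram_mor_eqI[of E]) (simp_all add: D mors pd F.source F.target)
  next
    case (6 m n)
    then have m: "is_diagram_mor C m" "is_diagram_mor C n" and eq: "Src n = Tgt m"
      by (simp_all add: Arr_Diag)
    interpret m: diagram_morphism C m by unfold_locales fact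
    interpret n: diagram_morphism C n by unfold_locales fact
    show ?case by (rule diagram_mor_eqI[of E]) (simp_all add: m eq mors pd F.source F.target)
  qed (auto simp: is_category_Diag F.source F.target Obj_Diag Arr_Diag pd diagram_mor_src diagram_mor_tgt,
       auto simp: push_def Obj_Diag Arr_Diag)
qed

lemma push_diagram_id [simp]: "is_diagram C D \<Longrightarrow> push_diagram (id_functor C) D = D"
  using diagram_functor[of C D] by (intro diagram.equality) simp_all

text \<open>Strictness of \<open>Diag\<close> as a 2-functor, on objects. It identifies the source
  and target of a pushed transformation between composite functors with iterated pushforwards,
  without which the factors in the coherence laws would not visibly compose.\<close>

lemma push_diagram_fcomp:
  "is_diagram C D \<Longrightarrow> push_diagram (fcomp C G F) D = push_diagram G (push_diagram F D)"
  using diagram_functor[of C D] by (intro diagram.equality) (simp_all add: fcomp_fcomp)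

lemma push_nt_sel [simp]:
  assumes "is_diagram C D"
  shows "Src (push_nt C F G \<alpha> D) = push_diagram F D" "Tgt (push_nt C F G \<alpha> D) = push_diagram G D"
    "MFun (push_nt C F G \<alpha> D) = id_functor (Shape D)"
    "x \<in> Obj (Shape D) \<Longrightarrow> MTrans (push_nt C F G \<alpha> D) x = \<alpha> (FOb (Fun D) x)"
  using assms by (simp_all add: push_nt_def Obj_Diag whisker_right_def)

lemma is_diagram_mor_push_nt:
  assumes "nat_trans C E F G \<alpha>" "is_diagram C D"
  shows "is_diagram_mor E (push_nt C F G \<alpha> D)"
proof -
  interpret nat_trans C E F G \<alpha> by fact
  interpret D: is_functor "Shape D" C "Fun D" using assms(2) by (rule diagram_functor)
  have ext: "MTrans (push_nt C F G \<alpha> D) \<in> extensional (Obj (Shape D))"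
    using assms(2) by (simp add: push_nt_def Obj_Diag whisker_right_def)
  show ?thesis
  proof (rule is_diagram_morI, goal_cases)
    case (5 f)
    then show ?case using assms(2) naturality[of "FAr (Fun D) f"] by simp
  qed (use assms ext in \<open>auto simp: is_diagram_push[OF dom_functor] is_diagram_push[OF cod_functor] diagram_category\<close>)
qed

section \<open>The terminal shape and the unit\<close>

lemma one_sel [simp]:
  "Obj one = {pt}" "Arr one = {pt}" "Dom one pt = pt" "Cod one pt = pt" "Ide one pt = pt"
  "Comp one pt pt = pt"
  by (simp_all add: one_def)

lemma is_category_one: "is_category one"
  by (rule is_categoryI) (auto simp: one_def)

lemma small_category_one: "small_category one"
  using small_pair[of pt pt] by (simp add: small_category_def is_category_one)

lemma point_sel [simp]:
  "Shape (point C x) = one" "FOb (Fun (point C x)) pt = x" "FAr (Fun (point C x)) pt = Ide C x"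
  by (simp_all add: point_def)

lemma is_diagram_point: "is_category C \<Longrightarrow> x \<in> Obj C \<Longrightarrow> is_diagram C (point C x)"
proof -
  assume C: "is_category C" and x: "x \<in> Obj C"
  interpret is_category C by fact
  show ?thesis
    by (intro is_diagramI is_functorI) (use C x in \<open>auto simp: small_category_one is_category_one\<close>, auto simp: point_def)
qed

lemma eta_sel [simp]:
  "x \<in> Obj C \<Longrightarrow> FOb (eta C) x = point C x"
  "f \<in> Arr C \<Longrightarrow> Src (FAr (eta C) f) = point C (Dom C f)"
  "f \<in> Arr C \<Longrightarrow> Tgt (FAr (eta C) f) = point C (Cod C f)"
  "f \<in> Arr C \<Longrightarrow> MFun (FAr (eta C) f) = id_functor one"
  "f \<in> Arr C \<Longrightarrow> MTrans (FAr (eta C) f) pt = f"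
  by (simp_all add: eta_def)

lemma is_diagram_mor_eta:
  assumes "is_category C" "f \<in> Arr C"
  shows "is_diagram_mor C (FAr (eta C) f)"
proof -
  interpret is_category C by fact
  show ?thesis
    by (rule is_diagram_morI)
      (use assms in \<open>auto simp: is_diagram_point is_category_one intro: is_functor_id\<close>, simp add: eta_def)
qed

lemma is_functor_eta:
  assumes "is_category C"
  shows "is_functor C (Diag C) (eta C :: (_, _, ('u::universe, _, _) diagram, _) cfunctor)"
proof -
  interpret is_category C by fact
  note mors = is_diagram_mor_ide is_diagram_mor_comp diagram_mor_src diagram_mor_tgt
  show ?thesis
  proof (rule is_functorI, goal_cases)
    case (5 x)
    then show ?case using assms
      by (intro diagram_mor_eqI[of C]) (auto simp: is_diagram_point is_diagram_mor_eta mors)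
  next
    case (6 f g)
    then show ?case using assms
      by (intro diagram_mor_eqI[of C]) (auto simp: is_diagram_point is_diagram_mor_eta mors)
  qed (use assms in \<open>auto simp: is_category_Diag Obj_Diag Arr_Diag is_diagram_point is_diagram_mor_eta\<close>,
     auto simp: eta_def)
qed

section \<open>The Grothendieck construction\<close>

lemma small_subset: "small X \<Longrightarrow> Y \<subseteq> X \<Longrightarrow> small Y"
  using separation unfolding small_def by blast

text \<open>Replacement makes a set of the codes \<open>set_of (Y x)\<close>; the union axiom
  applied to that set gives the union of the family.\<close>

lemma small_UN:
  fixes Y :: "'u::universe \<Rightarrow> 'u set"
  assumes "small X" "\<And>x. x \<in> X \<Longrightarrow> small (Y x)"
  shows "small (\<Union>x\<in>X. Y x)"
proof -
  obtain z where z: "elts z = (\<lambda>x. set_of (Y x)) ` X"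
    using small_image[OF assms(1)] unfolding small_def by blast
  have "(\<Union>y\<in>elts z. elts y) = (\<Union>x\<in>X. Y x)"
    using assms(2) by (simp add: z elts_set_of)
  then show ?thesis using union_set[of z] by (simp add: small_def)
qed

section \<open>Objects and arrows of the Grothendieck construction in coded form\<close>

lemma triple_inject [simp]: "triple x j f = triple x' j' f' \<longleftrightarrow> x = x' \<and> j = j' \<and> f = f'"
  by (simp add: triple_def)

lemma triple_sel [simp]: "tr_src (triple x j f) = x" "tr_base (triple x j f) = j" "tr_fib (triple x j f) = f"
  by (simp_all add: triple_def tr_src_def tr_base_def tr_fib_def)

lemma groth_sel: "Obj (groth D) = groth_obj D" "Arr (groth D) = groth_arr D"
  by (simp_all add: groth_def)

lemma groth_obj_iff [simp]: "opair x y \<in> Obj (groth D) \<longleftrightarrow> x \<in> Obj (Shape D) \<and> y \<in> Obj (fibre D x)"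
  by (auto simp: groth_sel groth_obj_def)

lemma groth_arr_iff [simp]: "triple y j f \<in> Arr (groth D) \<longleftrightarrow>
    j \<in> Arr (Shape D) \<and> y \<in> Obj (fibre D (Dom (Shape D) j)) \<and>
    f \<in> Arr (fibre D (Cod (Shape D) j)) \<and> Dom (fibre D (Cod (Shape D) j)) f = FOb (transport D j) y"
  by (auto simp: groth_sel groth_arr_def)

lemma groth_objE:
  assumes "p \<in> Obj (groth D)"
  obtains x y where "p = opair x y" "x \<in> Obj (Shape D)" "y \<in> Obj (fibre D x)"
  using assms by (auto simp: groth_sel groth_obj_def)

lemma groth_arrE:
  assumes "q \<in> Arr (groth D)"
  obtains y j f where "q = triple y j f" "j \<in> Arr (Shape D)" "y \<in> Obj (fibre D (Dom (Shape D) j))"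
    "f \<in> Arr (fibre D (Cod (Shape D) j))" "Dom (fibre D (Cod (Shape D) j)) f = FOb (transport D j) y"
  using assms by (auto simp: groth_sel groth_arr_def)

lemma groth_dom_cod [simp]:
  assumes "triple y j f \<in> Arr (groth D)"
  shows "Dom (groth D) (triple y j f) = opair (Dom (Shape D) j) y"
    "Cod (groth D) (triple y j f) = opair (Cod (Shape D) j) (Cod (fibre D (Cod (Shape D) j)) f)"
  using assms unfolding groth_sel by (simp_all add: groth_def groth_dom_def groth_cod_def)

lemma groth_ide [simp]:
  assumes "opair x y \<in> Obj (groth D)"
  shows "Ide (groth D) (opair x y) = triple y (Ide (Shape D) x) (Ide (fibre D x) y)"
  using assms unfolding groth_sel by (simp add: groth_def)

text \<open>Composability of coded arrows splits, by injectivity of pairing, into a condition in the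
  base and one in the fibre; the last two premises are these halves.\<close>

lemma groth_comp [simp]:
  assumes "triple y j f \<in> Arr (groth D)" "triple y' j' f' \<in> Arr (groth D)"
    and "Dom (Shape D) j' = Cod (Shape D) j" "y' = Cod (fibre D (Cod (Shape D) j)) f"
  shows "Comp (groth D) (triple y' j' f') (triple y j f) =
    triple y (Comp (Shape D) j' j) (Comp (fibre D (Cod (Shape D) j')) f' (FAr (transport D j') f))"
  using assms groth_dom_cod[OF assms(1)] groth_dom_cod[OF assms(2)] unfolding groth_sel
  by (simp add: groth_def)

text \<open>A functor into \<open>Diag C\<close> has two layers: \<open>fibre\<close> and
  \<open>transport\<close> form a strict functor to small categories, while \<open>fdiag\<close> and
  \<open>ftrans\<close> are functors to \<open>C\<close> on the fibres with comparison
  transformations along the transports. The facts below separate the functoriality of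
  \<open>D\<close> into these layers.\<close>

locale diagram_of_diagrams =
  fixes C :: "('o, 'a) category" and D :: "('u::universe, 'o, 'a) diagram2"
  assumes base: "is_category C" and diagram: "is_diagram (Diag C) D"
begin

sublocale base: is_category C by (rule base)

sublocale I: is_functor "Shape D" "Diag C" "Fun D"
  using diagram by (rule diagram_functor)

lemma is_diagram_at: "x \<in> Obj (Shape D) \<Longrightarrow> is_diagram C (FOb (Fun D) x)"
  using I.obj_in by (simp add: Obj_Diag)

lemma fibre_category: "x \<in> Obj (Shape D) \<Longrightarrow> is_category (fibre D x)"
  using is_diagram_at unfolding fibre_def by (rule diagram_category)

lemma fdiag_functor: "x \<in> Obj (Shape D) \<Longrightarrow> is_functor (fibre D x) C (fdiag D x)"
  using is_diagram_at unfolding fibre_def fdiag_def by (rule diagram_functor)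

lemma is_diagram_mor_at:
  assumes "j \<in> Arr (Shape D)"
  shows "is_diagram_mor C (FAr (Fun D) j)" "Src (FAr (Fun D) j) = FOb (Fun D) (Dom (Shape D) j)"
    "Tgt (FAr (Fun D) j) = FOb (Fun D) (Cod (Shape D) j)"
proof -
  show m: "is_diagram_mor C (FAr (Fun D) j)" using I.arr_in[OF assms] by (simp add: Arr_Diag)
  show "Src (FAr (Fun D) j) = FOb (Fun D) (Dom (Shape D) j)"
    "Tgt (FAr (Fun D) j) = FOb (Fun D) (Cod (Shape D) j)"
    using I.dom_arr[OF assms] I.cod_arr[OF assms] m by simp_all
qed

lemma transport_functor:
  assumes "j \<in> Arr (Shape D)"
  shows "is_functor (fibre D (Dom (Shape D) j)) (fibre D (Cod (Shape D) j)) (transport D j)"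
  using diagram_mor_functor[OF is_diagram_mor_at(1)[OF assms]] assms
  by (simp add: is_diagram_mor_at fibre_def transport_def)

lemma ftrans_nat:
  assumes "j \<in> Arr (Shape D)"
  shows "nat_trans (fibre D (Dom (Shape D) j)) C (fdiag D (Dom (Shape D) j))
    (fcomp (fibre D (Dom (Shape D) j)) (fdiag D (Cod (Shape D) j)) (transport D j)) (ftrans D j)"
  using diagram_mor_nat[OF is_diagram_mor_at(1)[OF assms]] assms
  by (simp add: is_diagram_mor_at fibre_def transport_def fdiag_def ftrans_def)

text \<open>The fibres form a family of categories indexed by \<open>x\<close>, and one arrow of the
  Grothendieck construction involves several of them. The category laws are therefore restated with
  \<open>x\<close> free, where an interpretation would fix one fibre; the same is done below for
  \<open>fdiag\<close>, \<open>transport\<close> and \<open>ftrans\<close>.\<close>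

lemma fibre_simps [simp]:
  assumes "x \<in> Obj (Shape D)"
  shows "f \<in> Arr (fibre D x) \<Longrightarrow> Dom (fibre D x) f \<in> Obj (fibre D x)"
    "f \<in> Arr (fibre D x) \<Longrightarrow> Cod (fibre D x) f \<in> Obj (fibre D x)"
    "y \<in> Obj (fibre D x) \<Longrightarrow> Ide (fibre D x) y \<in> Arr (fibre D x)"
    "y \<in> Obj (fibre D x) \<Longrightarrow> Dom (fibre D x) (Ide (fibre D x) y) = y"
    "y \<in> Obj (fibre D x) \<Longrightarrow> Cod (fibre D x) (Ide (fibre D x) y) = y"
    "f \<in> Arr (fibre D x) \<Longrightarrow> g \<in> Arr (fibre D x) \<Longrightarrow> Cod (fibre D x) f = Dom (fibre D x) g \<Longrightarrow>
      Comp (fibre D x) g f \<in> Arr (fibre D x)"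
    "f \<in> Arr (fibre D x) \<Longrightarrow> g \<in> Arr (fibre D x) \<Longrightarrow> Cod (fibre D x) f = Dom (fibre D x) g \<Longrightarrow>
      Dom (fibre D x) (Comp (fibre D x) g f) = Dom (fibre D x) f"
    "f \<in> Arr (fibre D x) \<Longrightarrow> g \<in> Arr (fibre D x) \<Longrightarrow> Cod (fibre D x) f = Dom (fibre D x) g \<Longrightarrow>
      Cod (fibre D x) (Comp (fibre D x) g f) = Cod (fibre D x) g"
    "f \<in> Arr (fibre D x) \<Longrightarrow> y = Dom (fibre D x) f \<Longrightarrow> Comp (fibre D x) f (Ide (fibre D x) y) = f"
    "f \<in> Arr (fibre D x) \<Longrightarrow> y = Cod (fibre D x) f \<Longrightarrow> Comp (fibre D x) (Ide (fibre D x) y) f = f"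
    "f \<in> Arr (fibre D x) \<Longrightarrow> g \<in> Arr (fibre D x) \<Longrightarrow> h \<in> Arr (fibre D x) \<Longrightarrow>
      Cod (fibre D x) f = Dom (fibre D x) g \<Longrightarrow> Cod (fibre D x) g = Dom (fibre D x) h \<Longrightarrow>
      Comp (fibre D x) (Comp (fibre D x) h g) f = Comp (fibre D x) h (Comp (fibre D x) g f)"
proof -
  interpret F: is_category "fibre D x" using assms by (rule fibre_category)
  show "f \<in> Arr (fibre D x) \<Longrightarrow> Dom (fibre D x) f \<in> Obj (fibre D x)"
    "f \<in> Arr (fibre D x) \<Longrightarrow> Cod (fibre D x) f \<in> Obj (fibre D x)"
    "y \<in> Obj (fibre D x) \<Longrightarrow> Ide (fibre D x) y \<in> Arr (fibre D x)"
    "y \<in> Obj (fibre D x) \<Longrightarrow> Dom (fibre D x) (Ide (fibre D x) y) = y"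
    "y \<in> Obj (fibre D x) \<Longrightarrow> Cod (fibre D x) (Ide (fibre D x) y) = y"
    "f \<in> Arr (fibre D x) \<Longrightarrow> g \<in> Arr (fibre D x) \<Longrightarrow> Cod (fibre D x) f = Dom (fibre D x) g \<Longrightarrow>
      Comp (fibre D x) g f \<in> Arr (fibre D x)"
    "f \<in> Arr (fibre D x) \<Longrightarrow> g \<in> Arr (fibre D x) \<Longrightarrow> Cod (fibre D x) f = Dom (fibre D x) g \<Longrightarrow>
      Dom (fibre D x) (Comp (fibre D x) g f) = Dom (fibre D x) f"
    "f \<in> Arr (fibre D x) \<Longrightarrow> g \<in> Arr (fibre D x) \<Longrightarrow> Cod (fibre D x) f = Dom (fibre D x) g \<Longrightarrow>
      Cod (fibre D x) (Comp (fibre D x) g f) = Cod (fibre D x) g"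
    "f \<in> Arr (fibre D x) \<Longrightarrow> y = Dom (fibre D x) f \<Longrightarrow> Comp (fibre D x) f (Ide (fibre D x) y) = f"
    "f \<in> Arr (fibre D x) \<Longrightarrow> y = Cod (fibre D x) f \<Longrightarrow> Comp (fibre D x) (Ide (fibre D x) y) f = f"
    "f \<in> Arr (fibre D x) \<Longrightarrow> g \<in> Arr (fibre D x) \<Longrightarrow> h \<in> Arr (fibre D x) \<Longrightarrow>
      Cod (fibre D x) f = Dom (fibre D x) g \<Longrightarrow> Cod (fibre D x) g = Dom (fibre D x) h \<Longrightarrow>
      Comp (fibre D x) (Comp (fibre D x) h g) f = Comp (fibre D x) h (Comp (fibre D x) g f)"
    by (simp_all add: F.comp_comp)
qed

lemma fdiag_simps [simp]:
  assumes "x \<in> Obj (Shape D)"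
  shows "y \<in> Obj (fibre D x) \<Longrightarrow> FOb (fdiag D x) y \<in> Obj C"
    "f \<in> Arr (fibre D x) \<Longrightarrow> FAr (fdiag D x) f \<in> Arr C"
    "f \<in> Arr (fibre D x) \<Longrightarrow> Dom C (FAr (fdiag D x) f) = FOb (fdiag D x) (Dom (fibre D x) f)"
    "f \<in> Arr (fibre D x) \<Longrightarrow> Cod C (FAr (fdiag D x) f) = FOb (fdiag D x) (Cod (fibre D x) f)"
    "y \<in> Obj (fibre D x) \<Longrightarrow> FAr (fdiag D x) (Ide (fibre D x) y) = Ide C (FOb (fdiag D x) y)"
    "f \<in> Arr (fibre D x) \<Longrightarrow> g \<in> Arr (fibre D x) \<Longrightarrow> Cod (fibre D x) f = Dom (fibre D x) g \<Longrightarrow>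
      FAr (fdiag D x) (Comp (fibre D x) g f) = Comp C (FAr (fdiag D x) g) (FAr (fdiag D x) f)"
proof -
  interpret F: is_functor "fibre D x" C "fdiag D x" using assms by (rule fdiag_functor)
  show "y \<in> Obj (fibre D x) \<Longrightarrow> FOb (fdiag D x) y \<in> Obj C"
    "f \<in> Arr (fibre D x) \<Longrightarrow> FAr (fdiag D x) f \<in> Arr C"
    "f \<in> Arr (fibre D x) \<Longrightarrow> Dom C (FAr (fdiag D x) f) = FOb (fdiag D x) (Dom (fibre D x) f)"
    "f \<in> Arr (fibre D x) \<Longrightarrow> Cod C (FAr (fdiag D x) f) = FOb (fdiag D x) (Cod (fibre D x) f)"
    "y \<in> Obj (fibre D x) \<Longrightarrow> FAr (fdiag D x) (Ide (fibre D x) y) = Ide C (FOb (fdiag D x) y)"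
    "f \<in> Arr (fibre D x) \<Longrightarrow> g \<in> Arr (fibre D x) \<Longrightarrow> Cod (fibre D x) f = Dom (fibre D x) g \<Longrightarrow>
      FAr (fdiag D x) (Comp (fibre D x) g f) = Comp C (FAr (fdiag D x) g) (FAr (fdiag D x) f)"
    by simp_all
qed

text \<open>The endpoints are variables bound by equations, so that the rules still apply when
  composability has replaced the domain of one base arrow by the codomain of another.\<close>

lemma transport_simps [simp]:
  assumes "j \<in> Arr (Shape D)" "Dom (Shape D) j = x" "Cod (Shape D) j = x'"
  shows "y \<in> Obj (fibre D x) \<Longrightarrow> FOb (transport D j) y \<in> Obj (fibre D x')"
    "f \<in> Arr (fibre D x) \<Longrightarrow> FAr (transport D j) f \<in> Arr (fibre D x')"
    "f \<in> Arr (fibre D x) \<Longrightarrow>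
      Dom (fibre D x') (FAr (transport D j) f) = FOb (transport D j) (Dom (fibre D x) f)"
    "f \<in> Arr (fibre D x) \<Longrightarrow>
      Cod (fibre D x') (FAr (transport D j) f) = FOb (transport D j) (Cod (fibre D x) f)"
    "y \<in> Obj (fibre D x) \<Longrightarrow>
      FAr (transport D j) (Ide (fibre D x) y) = Ide (fibre D x') (FOb (transport D j) y)"
    "f \<in> Arr (fibre D x) \<Longrightarrow> g \<in> Arr (fibre D x) \<Longrightarrow> Cod (fibre D x) f = Dom (fibre D x) g \<Longrightarrow>
      FAr (transport D j) (Comp (fibre D x) g f) =
      Comp (fibre D x') (FAr (transport D j) g) (FAr (transport D j) f)"
proof -
  interpret F: is_functor "fibre D x" "fibre D x'" "transport D j"
    using assms transport_functor by blast
  show "y \<in> Obj (fibre D x) \<Longrightarrow> FOb (transport D j) y \<in> Obj (fibre D x')"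
    "f \<in> Arr (fibre D x) \<Longrightarrow> FAr (transport D j) f \<in> Arr (fibre D x')"
    "f \<in> Arr (fibre D x) \<Longrightarrow>
      Dom (fibre D x') (FAr (transport D j) f) = FOb (transport D j) (Dom (fibre D x) f)"
    "f \<in> Arr (fibre D x) \<Longrightarrow>
      Cod (fibre D x') (FAr (transport D j) f) = FOb (transport D j) (Cod (fibre D x) f)"
    "y \<in> Obj (fibre D x) \<Longrightarrow>
      FAr (transport D j) (Ide (fibre D x) y) = Ide (fibre D x') (FOb (transport D j) y)"
    "f \<in> Arr (fibre D x) \<Longrightarrow> g \<in> Arr (fibre D x) \<Longrightarrow> Cod (fibre D x) f = Dom (fibre D x) g \<Longrightarrow>
      FAr (transport D j) (Comp (fibre D x) g f) =
      Comp (fibre D x') (FAr (transport D j) g) (FAr (transport D j) f)"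
    by simp_all
qed

lemma ftrans_simps [simp]:
  assumes "j \<in> Arr (Shape D)" "y \<in> Obj (fibre D (Dom (Shape D) j))"
  shows "ftrans D j y \<in> Arr C" "Dom C (ftrans D j y) = FOb (fdiag D (Dom (Shape D) j)) y"
    "Cod C (ftrans D j y) = FOb (fdiag D (Cod (Shape D) j)) (FOb (transport D j) y)"
proof -
  interpret N: nat_trans "fibre D (Dom (Shape D) j)" C "fdiag D (Dom (Shape D) j)"
    "fcomp (fibre D (Dom (Shape D) j)) (fdiag D (Cod (Shape D) j)) (transport D j)" "ftrans D j"
    using assms(1) by (rule ftrans_nat)
  show "ftrans D j y \<in> Arr C" "Dom C (ftrans D j y) = FOb (fdiag D (Dom (Shape D) j)) y"
    "Cod C (ftrans D j y) = FOb (fdiag D (Cod (Shape D) j)) (FOb (transport D j) y)"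
    using assms by simp_all
qed

lemma ftrans_natural:
  assumes "j \<in> Arr (Shape D)" "f \<in> Arr (fibre D (Dom (Shape D) j))"
  shows "Comp C (ftrans D j (Cod (fibre D (Dom (Shape D) j)) f)) (FAr (fdiag D (Dom (Shape D) j)) f) =
    Comp C (FAr (fdiag D (Cod (Shape D) j)) (FAr (transport D j) f))
      (ftrans D j (Dom (fibre D (Dom (Shape D) j)) f))"
proof -
  interpret N: nat_trans "fibre D (Dom (Shape D) j)" C "fdiag D (Dom (Shape D) j)"
    "fcomp (fibre D (Dom (Shape D) j)) (fdiag D (Cod (Shape D) j)) (transport D j)" "ftrans D j"
    using assms(1) by (rule ftrans_nat)
  show ?thesis using N.naturality assms by simp
qed

lemma transport_ide [simp]:
  assumes "x \<in> Obj (Shape D)"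
  shows "y \<in> Obj (fibre D x) \<Longrightarrow> FOb (transport D (Ide (Shape D) x)) y = y"
    "f \<in> Arr (fibre D x) \<Longrightarrow> FAr (transport D (Ide (Shape D) x)) f = f"
    "y \<in> Obj (fibre D x) \<Longrightarrow> ftrans D (Ide (Shape D) x) y = Ide C (FOb (fdiag D x) y)"
  using assms is_diagram_at[OF assms]
  by (simp_all add: transport_def ftrans_def fibre_def fdiag_def)

text \<open>These are the components of a single equation in \<open>Diag C\<close>, the preservation
  of a composite by \<open>Fun D\<close>. In the last one \<open>ftrans D k\<close> is taken at the
  transported object, as composition in \<open>Diag C\<close> prescribes.\<close>

lemma transport_comp [simp]:
  assumes "j \<in> Arr (Shape D)" "k \<in> Arr (Shape D)" "Cod (Shape D) j = Dom (Shape D) k"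
  shows "y \<in> Obj (fibre D (Dom (Shape D) j)) \<Longrightarrow>
      FOb (transport D (Comp (Shape D) k j)) y = FOb (transport D k) (FOb (transport D j) y)"
    "f \<in> Arr (fibre D (Dom (Shape D) j)) \<Longrightarrow>
      FAr (transport D (Comp (Shape D) k j)) f = FAr (transport D k) (FAr (transport D j) f)"
    "y \<in> Obj (fibre D (Dom (Shape D) j)) \<Longrightarrow> ftrans D (Comp (Shape D) k j) y =
      Comp C (ftrans D k (FOb (transport D j) y)) (ftrans D j y)"
  using assms by (simp_all add: transport_def ftrans_def fibre_def is_diagram_mor_at)

text \<open>Beyond the category laws in the base and the fibres, the unit and associativity laws
  rest on strict functoriality of the transports: a fibre arrow carried along a composite base arrow
  must equal the one carried in two stages, and carrying it along an identity must do
  nothing.\<close>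

lemma is_category_groth: "is_category (groth D)"
proof (rule is_categoryI, goal_cases)
  case (1 q)
  then show ?case by (auto elim!: groth_arrE)
next
  case (2 q)
  then show ?case by (auto elim!: groth_arrE)
next
  case (3 p)
  then show ?case by (auto elim!: groth_objE)
next
  case (4 q r)
  then show ?case by (auto elim!: groth_arrE)
next
  case (5 q)
  then show ?case by (auto elim!: groth_arrE)
next
  case (6 q)
  then show ?case by (auto elim!: groth_arrE)
next
  case (7 q r s)
  then show ?case by (auto elim!: groth_arrE simp: I.C.comp_comp)
next
  case (11 q r)
  then show ?case by (auto simp: groth_def)
qed (auto simp: groth_def groth_dom_def groth_cod_def)

lemma small_category_groth: "small_category (groth D)"
proof -
  have S: "small (Obj (Shape D))" "small (Arr (Shape D))"
    using diagram_small[OF diagram] by (simp_all add: small_category_def)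
  have F: "small (Obj (fibre D x))" "small (Arr (fibre D x))" if "x \<in> Obj (Shape D)" for x
    using diagram_small[OF is_diagram_at[OF that]] by (simp_all add: small_category_def fibre_def)
  have "Obj (groth D) \<subseteq> (\<Union>x\<in>Obj (Shape D). opair x ` Obj (fibre D x))"
    by (auto elim!: groth_objE)
  moreover have "Arr (groth D) \<subseteq> (\<Union>j\<in>Arr (Shape D). \<Union>y\<in>Obj (fibre D (Dom (Shape D) j)).
      triple y j ` Arr (fibre D (Cod (Shape D) j)))"
    by (auto elim!: groth_arrE)
  moreover have "small (\<Union>x\<in>Obj (Shape D). opair x ` Obj (fibre D x))"
    by (intro small_UN small_image S F)
  moreover have "small (\<Union>j\<in>Arr (Shape D). \<Union>y\<in>Obj (fibre D (Dom (Shape D) j)).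
      triple y j ` Arr (fibre D (Cod (Shape D) j)))"
    by (intro small_UN small_image S F I.C.dom_obj I.C.cod_obj)
  ultimately show ?thesis unfolding small_category_def
    using is_category_groth small_subset by blast
qed

end

section \<open>The multiplication\<close>

lemma mu_obj_sel [simp]:
  "Shape (mu_obj C D) = groth D"
  "opair x y \<in> Obj (groth D) \<Longrightarrow> FOb (Fun (mu_obj C D)) (opair x y) = FOb (fdiag D x) y"
  "triple y j f \<in> Arr (groth D) \<Longrightarrow> FAr (Fun (mu_obj C D)) (triple y j f) =
    Comp C (FAr (fdiag D (Cod (Shape D) j)) f) (ftrans D j y)"
  unfolding groth_sel by (simp_all add: mu_obj_def)

context diagram_of_diagrams
begin

lemma is_diagram_mu_obj: "is_diagram C (mu_obj C D)"
proof (rule is_diagramI)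
  show "is_functor (Shape (mu_obj C D)) C (Fun (mu_obj C D))"
  proof (rule is_functorI, goal_cases)
    case (3 p)
    then show ?case by (auto elim!: groth_objE)
  next
    case (4 q)
    then show ?case by (auto elim!: groth_arrE)
  next
    case (5 p)
    then show ?case by (auto elim!: groth_objE)
  next
    case (6 q r)
    then obtain y j f y' j' f' where q: "q = triple y j f" "j \<in> Arr (Shape D)"
        "y \<in> Obj (fibre D (Dom (Shape D) j))" "f \<in> Arr (fibre D (Cod (Shape D) j))"
        "Dom (fibre D (Cod (Shape D) j)) f = FOb (transport D j) y"
      and r: "r = triple y' j' f'" "j' \<in> Arr (Shape D)"
        "y' \<in> Obj (fibre D (Dom (Shape D) j'))" "f' \<in> Arr (fibre D (Cod (Shape D) j'))"
        "Dom (fibre D (Cod (Shape D) j')) f' = FOb (transport D j') y'"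
      by (auto elim!: groth_arrE)
    have eq: "Dom (Shape D) j' = Cod (Shape D) j" "y' = Cod (fibre D (Cod (Shape D) j)) f"
      using 6 by (auto simp: q r)
    \<comment> \<open>In the image of the composite, both base parts act before both fibre parts; in
      the composite of the images they alternate. Naturality of \<open>ftrans D j'\<close> at
      \<open>f\<close> exchanges the two middle factors.\<close>
    have nat: "Comp C (FAr (fdiag D (Cod (Shape D) j')) (FAr (transport D j') f))
         (ftrans D j' (FOb (transport D j) y)) =
       Comp C (ftrans D j' y') (FAr (fdiag D (Cod (Shape D) j)) f)"
      using ftrans_natural[of j' f] q r by (simp add: eq)
    show ?case
      using q r eq nat
      by (simp add: base.comp_comp) (simp add: base.comp_comp[symmetric])
  qed (use base in \<open>simp_all add: is_category_groth\<close>, simp_all add: mu_obj_def groth_sel)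
qed (simp add: small_category_groth)

end

lemma FOb_mu [simp]: "is_diagram (Diag C) D \<Longrightarrow> FOb (mu C) D = mu_obj C D"
  by (simp add: mu_def Obj_Diag)

lemma mu_mor_sel [simp]:
  assumes "is_diagram_mor (Diag C) m"
  shows "Src (FAr (mu C) m) = mu_obj C (Src m)" "Tgt (FAr (mu C) m) = mu_obj C (Tgt m)"
    "opair x y \<in> Obj (groth (Src m)) \<Longrightarrow> FOb (MFun (FAr (mu C) m)) (opair x y) =
      opair (FOb (MFun m) x) (FOb (MFun (MTrans m x)) y)"
    "triple y j f \<in> Arr (groth (Src m)) \<Longrightarrow> FAr (MFun (FAr (mu C) m)) (triple y j f) =
      triple (FOb (MFun (MTrans m (Dom (Shape (Src m)) j))) y) (FAr (MFun m) j)
        (FAr (MFun (MTrans m (Cod (Shape (Src m)) j))) f)"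
    "opair x y \<in> Obj (groth (Src m)) \<Longrightarrow>
      MTrans (FAr (mu C) m) (opair x y) = MTrans (MTrans m x) y"
  using assms unfolding groth_sel by (simp_all add: mu_def Arr_Diag Let_def)

text \<open>Such a morphism consists of a functor between base shapes and, over each base object, a
  morphism of diagrams \<open>MTrans m x\<close>. The latter has its own functor and transformation,
  so there are two kinds of naturality: inside each fibre (\<open>part_natural\<close>) and along
  base arrows (\<open>transport_natural\<close>).\<close>

locale diagram_of_diagrams_morphism =
  fixes C :: "('o, 'a) category"
    and m :: "('u::universe, ('u, 'o, 'a) diagram, ('u, 'o, 'a) diagram_mor) diagram_mor"
  assumes base: "is_category C" and mor: "is_diagram_mor (Diag C) m"
begin

sublocale diagram_morphism "Diag C" m by unfold_locales (rule mor)

sublocale S: diagram_of_diagrams C "Src m"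
  by (rule diagram_of_diagrams.intro[OF base diagram_mor_src[OF mor]])

sublocale D: diagram_of_diagrams C "Tgt m"
  by (rule diagram_of_diagrams.intro[OF base diagram_mor_tgt[OF mor]])

lemma is_diagram_mor_at:
  assumes "x \<in> Obj (Shape (Src m))"
  shows "is_diagram_mor C (MTrans m x)" "Src (MTrans m x) = FOb (Fun (Src m)) x"
    "Tgt (MTrans m x) = FOb (Fun (Tgt m)) (FOb (MFun m) x)"
proof -
  show m: "is_diagram_mor C (MTrans m x)" using N.comp_in[OF assms] by (simp add: Arr_Diag)
  show "Src (MTrans m x) = FOb (Fun (Src m)) x"
    "Tgt (MTrans m x) = FOb (Fun (Tgt m)) (FOb (MFun m) x)"
    using N.dom_comp[OF assms] N.cod_comp[OF assms] m assms by simp_all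
qed

lemma part_simps [simp]:
  assumes "x \<in> Obj (Shape (Src m))"
  shows "y \<in> Obj (fibre (Src m) x) \<Longrightarrow> FOb (MFun (MTrans m x)) y \<in> Obj (fibre (Tgt m) (FOb (MFun m) x))"
    "f \<in> Arr (fibre (Src m) x) \<Longrightarrow> FAr (MFun (MTrans m x)) f \<in> Arr (fibre (Tgt m) (FOb (MFun m) x))"
    "f \<in> Arr (fibre (Src m) x) \<Longrightarrow> Dom (fibre (Tgt m) (FOb (MFun m) x)) (FAr (MFun (MTrans m x)) f) =
      FOb (MFun (MTrans m x)) (Dom (fibre (Src m) x) f)"
    "f \<in> Arr (fibre (Src m) x) \<Longrightarrow> Cod (fibre (Tgt m) (FOb (MFun m) x)) (FAr (MFun (MTrans m x)) f) =
      FOb (MFun (MTrans m x)) (Cod (fibre (Src m) x) f)"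
    "y \<in> Obj (fibre (Src m) x) \<Longrightarrow> FAr (MFun (MTrans m x)) (Ide (fibre (Src m) x) y) =
      Ide (fibre (Tgt m) (FOb (MFun m) x)) (FOb (MFun (MTrans m x)) y)"
    "f \<in> Arr (fibre (Src m) x) \<Longrightarrow> g \<in> Arr (fibre (Src m) x) \<Longrightarrow>
      Cod (fibre (Src m) x) f = Dom (fibre (Src m) x) g \<Longrightarrow>
      FAr (MFun (MTrans m x)) (Comp (fibre (Src m) x) g f) = Comp (fibre (Tgt m) (FOb (MFun m) x))
        (FAr (MFun (MTrans m x)) g) (FAr (MFun (MTrans m x)) f)"
    "y \<in> Obj (fibre (Src m) x) \<Longrightarrow> MTrans (MTrans m x) y \<in> Arr C"
    "y \<in> Obj (fibre (Src m) x) \<Longrightarrow> Dom C (MTrans (MTrans m x) y) = FOb (fdiag (Src m) x) y"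
    "y \<in> Obj (fibre (Src m) x) \<Longrightarrow> Cod C (MTrans (MTrans m x) y) =
      FOb (fdiag (Tgt m) (FOb (MFun m) x)) (FOb (MFun (MTrans m x)) y)"
proof -
  interpret P: diagram_morphism C "MTrans m x"
    by unfold_locales (rule is_diagram_mor_at[OF assms])
  note at = is_diagram_mor_at(2,3)[OF assms]
  note rules = P.R.obj_in P.R.arr_in P.R.dom_arr P.R.cod_arr P.R.arr_ide P.R.arr_comp
    P.N.comp_in P.N.dom_comp P.N.cod_comp
  note rules' = rules[unfolded at, folded fibre_def fdiag_def]
  show "y \<in> Obj (fibre (Src m) x) \<Longrightarrow> FOb (MFun (MTrans m x)) y \<in> Obj (fibre (Tgt m) (FOb (MFun m) x))"
    "f \<in> Arr (fibre (Src m) x) \<Longrightarrow> FAr (MFun (MTrans m x)) f \<in> Arr (fibre (Tgt m) (FOb (MFun m) x))"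
    "f \<in> Arr (fibre (Src m) x) \<Longrightarrow> Dom (fibre (Tgt m) (FOb (MFun m) x)) (FAr (MFun (MTrans m x)) f) =
      FOb (MFun (MTrans m x)) (Dom (fibre (Src m) x) f)"
    "f \<in> Arr (fibre (Src m) x) \<Longrightarrow> Cod (fibre (Tgt m) (FOb (MFun m) x)) (FAr (MFun (MTrans m x)) f) =
      FOb (MFun (MTrans m x)) (Cod (fibre (Src m) x) f)"
    "y \<in> Obj (fibre (Src m) x) \<Longrightarrow> FAr (MFun (MTrans m x)) (Ide (fibre (Src m) x) y) =
      Ide (fibre (Tgt m) (FOb (MFun m) x)) (FOb (MFun (MTrans m x)) y)"
    "f \<in> Arr (fibre (Src m) x) \<Longrightarrow> g \<in> Arr (fibre (Src m) x) \<Longrightarrow>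
      Cod (fibre (Src m) x) f = Dom (fibre (Src m) x) g \<Longrightarrow>
      FAr (MFun (MTrans m x)) (Comp (fibre (Src m) x) g f) = Comp (fibre (Tgt m) (FOb (MFun m) x))
        (FAr (MFun (MTrans m x)) g) (FAr (MFun (MTrans m x)) f)"
    "y \<in> Obj (fibre (Src m) x) \<Longrightarrow> MTrans (MTrans m x) y \<in> Arr C"
    "y \<in> Obj (fibre (Src m) x) \<Longrightarrow> Dom C (MTrans (MTrans m x) y) = FOb (fdiag (Src m) x) y"
    "y \<in> Obj (fibre (Src m) x) \<Longrightarrow> Cod C (MTrans (MTrans m x) y) =
      FOb (fdiag (Tgt m) (FOb (MFun m) x)) (FOb (MFun (MTrans m x)) y)"
    by (simp_all add: rules' fibre_def[symmetric])
qed

lemma part_natural: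
  assumes "x \<in> Obj (Shape (Src m))" "f \<in> Arr (fibre (Src m) x)"
  shows "Comp C (MTrans (MTrans m x) (Cod (fibre (Src m) x) f)) (FAr (fdiag (Src m) x) f) =
    Comp C (FAr (fdiag (Tgt m) (FOb (MFun m) x)) (FAr (MFun (MTrans m x)) f))
      (MTrans (MTrans m x) (Dom (fibre (Src m) x) f))"
proof -
  interpret P: diagram_morphism C "MTrans m x"
    by unfold_locales (rule is_diagram_mor_at[OF assms(1)])
  note at = is_diagram_mor_at(2,3)[OF assms(1)]
  show ?thesis using P.N.naturality[unfolded at, folded fibre_def fdiag_def] assms(2)
    by (simp add: fibre_def)
qed

text \<open>The naturality square of \<open>MTrans m\<close> at \<open>j\<close> is an equation
  between morphisms of diagrams. Its functor part on objects, its functor part on arrows and its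
  transformation part are the three conclusions.\<close>

lemma transport_natural:
  assumes j: "j \<in> Arr (Shape (Src m))" and cod: "Cod (Shape (Src m)) j = x'"
  shows "y \<in> Obj (fibre (Src m) (Dom (Shape (Src m)) j)) \<Longrightarrow>
      FOb (MFun (MTrans m x')) (FOb (transport (Src m) j) y) =
      FOb (transport (Tgt m) (FAr (MFun m) j)) (FOb (MFun (MTrans m (Dom (Shape (Src m)) j))) y)"
    "f \<in> Arr (fibre (Src m) (Dom (Shape (Src m)) j)) \<Longrightarrow>
      FAr (MFun (MTrans m x')) (FAr (transport (Src m) j) f) =
      FAr (transport (Tgt m) (FAr (MFun m) j)) (FAr (MFun (MTrans m (Dom (Shape (Src m)) j))) f)"
    "y \<in> Obj (fibre (Src m) (Dom (Shape (Src m)) j)) \<Longrightarrow>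
      Comp C (MTrans (MTrans m x') (FOb (transport (Src m) j) y)) (ftrans (Src m) j y) =
      Comp C (ftrans (Tgt m) (FAr (MFun m) j) (FOb (MFun (MTrans m (Dom (Shape (Src m)) j))) y))
        (MTrans (MTrans m (Dom (Shape (Src m)) j)) y)"
proof -
  let ?l = "Comp (Diag C) (MTrans m (Cod (Shape (Src m)) j)) (FAr (Fun (Src m)) j)"
  let ?r = "Comp (Diag C) (FAr (Fun (Tgt m)) (FAr (MFun m) j)) (MTrans m (Dom (Shape (Src m)) j))"
  have eq: "?l = ?r" using N.naturality[OF j] j by simp
  note at = is_diagram_mor_at S.is_diagram_mor_at D.is_diagram_mor_at
  have "FOb (MFun ?l) y = FOb (MFun ?r) y" "FAr (MFun ?l) f = FAr (MFun ?r) f"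
    "MTrans ?l y = MTrans ?r y" by (simp_all only: eq)
  with j cod show "y \<in> Obj (fibre (Src m) (Dom (Shape (Src m)) j)) \<Longrightarrow>
      FOb (MFun (MTrans m x')) (FOb (transport (Src m) j) y) =
      FOb (transport (Tgt m) (FAr (MFun m) j)) (FOb (MFun (MTrans m (Dom (Shape (Src m)) j))) y)"
    "f \<in> Arr (fibre (Src m) (Dom (Shape (Src m)) j)) \<Longrightarrow>
      FAr (MFun (MTrans m x')) (FAr (transport (Src m) j) f) =
      FAr (transport (Tgt m) (FAr (MFun m) j)) (FAr (MFun (MTrans m (Dom (Shape (Src m)) j))) f)"
    "y \<in> Obj (fibre (Src m) (Dom (Shape (Src m)) j)) \<Longrightarrow>
      Comp C (MTrans (MTrans m x') (FOb (transport (Src m) j) y)) (ftrans (Src m) j y) =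
      Comp C (ftrans (Tgt m) (FAr (MFun m) j) (FOb (MFun (MTrans m (Dom (Shape (Src m)) j))) y))
        (MTrans (MTrans m (Dom (Shape (Src m)) j)) y)"
    by (simp_all add: at cod[symmetric] fibre_def transport_def ftrans_def)
qed

text \<open>The image of an arrow \<open>(j, f)\<close> has the right fibre domain because the
  functors between fibres commute with transport; the same commutation, on arrows, gives
  preservation of composites.\<close>

lemma is_diagram_mor_mu: "is_diagram_mor C (FAr (mu C) m)"
proof -
  have total: "is_functor (groth (Src m)) (groth (Tgt m)) (MFun (FAr (mu C) m))"
  proof (rule is_functorI, goal_cases)
    case (3 p)
    then show ?case using mor by (auto elim!: groth_objE)
  next
    case (4 q)
    then show ?case using mor by (auto elim!: groth_arrE simp: transport_natural)
  next
    case (5 p)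
    then show ?case using mor by (auto elim!: groth_objE)
  next
    case (6 q r)
    then show ?case using mor by (auto elim!: groth_arrE simp: transport_natural)
  qed (use mor in \<open>simp_all add: S.is_category_groth D.is_category_groth\<close>,
       simp_all add: mu_def Arr_Diag Let_def groth_sel)
  show ?thesis
  proof (rule is_diagram_morI, goal_cases)
    case (4 p)
    then show ?case using mor by (auto elim!: groth_objE)
  next
    case (5 q)
    then obtain y j f where q: "q = triple y j f" "j \<in> Arr (Shape (Src m))"
        "y \<in> Obj (fibre (Src m) (Dom (Shape (Src m)) j))" "f \<in> Arr (fibre (Src m) (Cod (Shape (Src m)) j))"
        "Dom (fibre (Src m) (Cod (Shape (Src m)) j)) f = FOb (transport (Src m) j) y"
      using mor by (auto elim!: groth_arrE)
    \<comment> \<open>An arrow acts as its fibre part \<open>f\<close> after its base part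
      \<open>j\<close>, so the required square is the fibre square at \<open>f\<close> pasted to the
      base square at \<open>j\<close>.\<close>
    note n = part_natural[of "Cod (Shape (Src m)) j" f] transport_natural(3)[of j _ y, OF _ refl]
    show ?case
      using q n mor S.base.comp_comp
      by (simp add: transport_natural(1) S.base.comp_comp[symmetric])
         (simp add: transport_natural(1) S.base.comp_comp)
  next
    case 6
    show ?case using mor by (simp add: mu_def Arr_Diag Let_def groth_sel)
  qed (use mor total in \<open>simp_all add: S.is_diagram_mu_obj D.is_diagram_mu_obj\<close>)
qed

end

text \<open>Functoriality makes \<open>push_diagram (mu C) D\<close> a diagram again, which is the
  ingredient of the source of the associator, and makes the target of the associativity isomorphism
  a functor.\<close>

lemma is_functor_mu:
  assumes "is_category C"
  shows "is_functor (Diag (Diag C)) (Diag C)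
    (mu C :: (('u::universe, 'o, 'a) diagram2, _, _, _) cfunctor)"
proof -
  have ob: "is_diagram C (mu_obj C D)" if "is_diagram (Diag C) D" for D :: "('u, 'o, 'a) diagram2"
    using that assms by (intro diagram_of_diagrams.is_diagram_mu_obj diagram_of_diagrams.intro)
  have ar: "is_diagram_mor C (FAr (mu C) m)" if "is_diagram_mor (Diag C) m"
    for m :: "('u, ('u, 'o, 'a) diagram, ('u, 'o, 'a) diagram_mor) diagram_mor"
    using that assms
    by (intro diagram_of_diagrams_morphism.is_diagram_mor_mu diagram_of_diagrams_morphism.intro)
  have cat: "is_category (Diag C :: (('u, 'o, 'a) diagram, _) category)"
    using assms by (rule is_category_Diag)
  note mors = is_diagram_mor_ide is_diagram_mor_comp diagram_mor_src diagram_mor_tgt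
  show ?thesis
  proof (rule is_functorI, goal_cases)
    case (5 D)
    then have D: "is_diagram (Diag C) D" by (simp add: Obj_Diag)
    interpret diagram_of_diagrams C D using assms D by (rule diagram_of_diagrams.intro)
    note id = mors(1)[OF cat D] mors(1)[OF assms ob[OF D]]
    show ?case
    proof (rule diagram_mor_eqI[of C], goal_cases)
      case (5 p)
      then show ?case using D id assms by (auto elim!: groth_objE simp: ob is_diagram_at simp flip: fibre_def)
    next
      case (6 q)
      then show ?case using D id assms by (auto elim!: groth_arrE simp: ob is_diagram_at simp flip: fibre_def)
    next
      case (7 p)
      then show ?case using D id assms
        by (auto elim!: groth_objE simp: ob is_diagram_at simp flip: fibre_def fdiag_def)
    qed (use D id in \<open>simp_all add: ar ob\<close>)
  next
    case (6 m n)
    then have m: "is_diagram_mor (Diag C) m" "is_diagram_mor (Diag C) n" and eq: "Src n = Tgt m"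
      by (simp_all add: Arr_Diag)
    interpret m: diagram_of_diagrams_morphism C m using assms m(1) by (rule diagram_of_diagrams_morphism.intro)
    interpret n: diagram_of_diagrams_morphism C n using assms m(2) by (rule diagram_of_diagrams_morphism.intro)
    have c: "is_diagram_mor (Diag C) (Comp (Diag (Diag C)) n m)" using m eq cat by (intro mors) auto
    have c': "is_diagram_mor C (Comp (Diag C) (FAr (mu C) n) (FAr (mu C) m))"
      using m eq assms by (intro mors ar) auto
    note at = m.is_diagram_mor_at n.is_diagram_mor_at
    show ?case
    proof (rule diagram_mor_eqI[of C], goal_cases)
      case (5 p)
      then show ?case using m eq c c'
        by (auto elim!: groth_objE simp: at ar simp flip: fibre_def)
    next
      case (6 q)
      then show ?case using m eq c c'
        by (auto elim!: groth_arrE simp: at ar m.transport_natural simp flip: fibre_def)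
    next
      case (7 p)
      then show ?case using m eq c c'
        by (auto elim!: groth_objE simp: at ar simp flip: fibre_def)
    qed (use m eq c c' in \<open>simp_all add: ar\<close>)
  qed (use assms cat in \<open>auto simp: is_category_Diag Obj_Diag Arr_Diag ob ar diagram_mor_src diagram_mor_tgt\<close>,
     auto simp: mu_def Obj_Diag Arr_Diag)
qed

section \<open>Unitor and associator\<close>

lemma unitor_r_sel [simp]:
  assumes "is_diagram C D"
  shows "Src (unitor_r C D) = D" "Tgt (unitor_r C D) = FOb (mu C) (FOb (push C (eta C)) D)"
    "x \<in> Obj (Shape D) \<Longrightarrow> FOb (MFun (unitor_r C D)) x = opair x pt"
    "f \<in> Arr (Shape D) \<Longrightarrow> FAr (MFun (unitor_r C D)) f = triple pt f pt"
    "x \<in> Obj (Shape D) \<Longrightarrow> MTrans (unitor_r C D) x = Ide C (FOb (Fun D) x)"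
  using assms by (simp_all add: unitor_r_def Obj_Diag)

text \<open>Over a diagram of one-object diagrams the Grothendieck construction is a copy of the
  base: an object only gains the coordinate \<open>pt\<close>, and an arrow \<open>f\<close> becomes
  \<open>triple pt f pt\<close>, on which the functor to \<open>C\<close> evaluates to an identity
  after the image of \<open>f\<close>.\<close>

lemma is_diagram_mor_unitor_r:
  fixes D :: "('u::universe, 'o, 'a) diagram"
  assumes "is_category C" "is_diagram C D"
  shows "is_diagram_mor C (unitor_r C D)"
proof -
  let ?E = "push_diagram (eta C) D :: ('u, 'o, 'a) diagram2"
  interpret D: is_functor "Shape D" C "Fun D" using assms(2) by (rule diagram_functor)
  have E: "is_diagram (Diag C) ?E"
    using is_functor_eta[OF assms(1)] assms(2) by (rule is_diagram_push)
  interpret E: diagram_of_diagrams C ?E using assms(1) E by (rule diagram_of_diagrams.intro)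
  have fib [simp]: "fibre ?E x = one" "FOb (fdiag ?E x) pt = FOb (Fun D) x"
      "FAr (fdiag ?E x) pt = Ide C (FOb (Fun D) x)" if "x \<in> Obj (Shape D)" for x
    using that by (simp_all add: fibre_def fdiag_def)
  have tra [simp]: "FOb (transport ?E j) pt = pt" "FAr (transport ?E j) pt = pt"
      "ftrans ?E j pt = FAr (Fun D) j" if "j \<in> Arr (Shape D)" for j
    using that by (simp_all add: transport_def ftrans_def)
  show ?thesis
  proof (rule is_diagram_morI, goal_cases)
    case 3
    show ?case
    proof (rule is_functorI, goal_cases)
      case 7
      show ?case using assms by (simp add: unitor_r_def Obj_Diag)
    next
      case 8
      show ?case using assms by (simp add: unitor_r_def Obj_Diag)
    qed (use assms E in \<open>simp_all add: D.source E.is_category_groth\<close>)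
  next
    case 6
    show ?case using assms by (simp add: unitor_r_def Obj_Diag)
  qed (use assms E in \<open>simp_all add: E.is_diagram_mu_obj\<close>)
qed

lemma assoc_a_sel [simp]:
  fixes D :: "('u::universe, ('u, 'o, 'a) diagram, ('u, 'o, 'a) diagram_mor) diagram2"
  assumes C: "is_category C" and D: "is_diagram (Diag (Diag C)) D"
  defines "S \<equiv> groth (push_diagram (mu C) D)"
  shows "Src (assoc_a C D) = mu_obj C (push_diagram (mu C) D)"
    "Tgt (assoc_a C D) = mu_obj C (mu_obj (Diag C) D)"
    "opair x (opair y z) \<in> Obj S \<Longrightarrow>
      FOb (MFun (assoc_a C D)) (opair x (opair y z)) = opair (opair x y) z"
    "triple (opair y z) j (triple z' k l) \<in> Arr S \<Longrightarrow>
      FAr (MFun (assoc_a C D)) (triple (opair y z) j (triple z' k l)) = triple z (triple y j k) l"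
    "p \<in> Obj S \<Longrightarrow> MTrans (assoc_a C D) p = Ide C (FOb (Fun (Src (assoc_a C D))) p)"
proof -
  have "is_diagram (Diag C) (push_diagram (mu C) D)"
    using is_functor_mu[OF C] D by (rule is_diagram_push)
  moreover have "is_diagram (Diag C) (mu_obj (Diag C) D)"
    using is_category_Diag[OF C] D
    by (intro diagram_of_diagrams.is_diagram_mu_obj diagram_of_diagrams.intro)
  \<comment> \<open>The map is restricted to the carrier of its source shape. Membership in
    \<open>S\<close> is kept as an opaque premise so that it matches this restriction literally;
    expanding it into conditions on coordinates would destroy the match.\<close>
  ultimately show "Src (assoc_a C D) = mu_obj C (push_diagram (mu C) D)"
    "Tgt (assoc_a C D) = mu_obj C (mu_obj (Diag C) D)"
    "opair x (opair y z) \<in> Obj S \<Longrightarrow>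
      FOb (MFun (assoc_a C D)) (opair x (opair y z)) = opair (opair x y) z"
    "triple (opair y z) j (triple z' k l) \<in> Arr S \<Longrightarrow>
      FAr (MFun (assoc_a C D)) (triple (opair y z) j (triple z' k l)) = triple z (triple y j k) l"
    "p \<in> Obj S \<Longrightarrow> MTrans (assoc_a C D) p = Ide C (FOb (Fun (Src (assoc_a C D))) p)"
    using D unfolding assoc_a_def S_def
    by (simp_all add: Obj_Diag Let_def del: groth_obj_iff groth_arr_iff)
qed

text \<open>Both shapes have arrows made of three parts \<open>j\<close>, \<open>k\<close>,
  \<open>l\<close> and differ in the starting points they record. With \<open>j\<close> outermost,
  the inner arrow also carries the image of \<open>z\<close> in the new fibre; with
  \<open>(j, k)\<close> outermost, only \<open>z\<close> and \<open>y\<close> are kept. The extra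
  point is determined by \<open>z\<close> (\<open>arrE\<close>), and the transports along
  \<open>(j, k)\<close> are the two-stage transports (\<open>traN\<close>), so rebracketing respects
  endpoints, identities and composites.\<close>

lemma is_diagram_mor_assoc_a:
  fixes D :: "('u::universe, ('u, 'o, 'a) diagram, ('u, 'o, 'a) diagram_mor) diagram2"
  assumes C: "is_category C" and D: "is_diagram (Diag (Diag C)) D"
  shows "is_diagram_mor C (assoc_a C D)"
proof -
  let ?M = "push_diagram (mu C) D" and ?N = "mu_obj (Diag C) D"
  interpret C: is_category C by fact
  interpret D: diagram_of_diagrams "Diag C" D
    using is_category_Diag[OF C] D by (rule diagram_of_diagrams.intro)
  have M: "is_diagram (Diag C) ?M" using is_functor_mu[OF C] D by (rule is_diagram_push)
  interpret M: diagram_of_diagrams C ?M using C M by (rule diagram_of_diagrams.intro)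
  have N: "is_diagram (Diag C) ?N" by (rule D.is_diagram_mu_obj)
  interpret N: diagram_of_diagrams C ?N using C N by (rule diagram_of_diagrams.intro)
  have at: "diagram_of_diagrams C (FOb (Fun D) x)" if "x \<in> Obj (Shape D)" for x
    using C D.is_diagram_at[OF that] by (rule diagram_of_diagrams.intro)
  have mor: "diagram_of_diagrams_morphism C (FAr (Fun D) j)" if "j \<in> Arr (Shape D)" for j
    using C D.is_diagram_mor_at(1)[OF that] by (rule diagram_of_diagrams_morphism.intro)
  have fib: "fibre D x = Shape (FOb (Fun D) x)" "fdiag D x = Fun (FOb (Fun D) x)"
    "transport D j = MFun (FAr (Fun D) j)" "ftrans D j = MTrans (FAr (Fun D) j)" for x j
    by (simp_all add: fibre_def fdiag_def transport_def ftrans_def)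
  have fibM: "fibre ?M x = groth (FOb (Fun D) x)" "fdiag ?M x = Fun (mu_obj C (FOb (Fun D) x))"
    if "x \<in> Obj (Shape D)" for x
    using that D.is_diagram_at[OF that] by (simp_all add: fibre_def fdiag_def)
  have traM: "transport ?M j = MFun (FAr (mu C) (FAr (Fun D) j))"
    "ftrans ?M j = MTrans (FAr (mu C) (FAr (Fun D) j))"
    if "j \<in> Arr (Shape D)" for j
    using that by (simp_all add: transport_def ftrans_def)
  have fibN: "fibre ?N (opair x y) = fibre (FOb (Fun D) x) y"
    "fdiag ?N (opair x y) = fdiag (FOb (Fun D) x) y"
    if "x \<in> Obj (Shape D)" "y \<in> Obj (Shape (FOb (Fun D) x))" for x y
    using that by (simp_all add: fibre_def fdiag_def)
  note rules = fib fibM traM fibN D.is_diagram_mor_at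
    D.is_diagram_at is_diagram_mor_ide is_diagram_mor_comp is_category_Diag[OF C]
  have objE: thesis if "p \<in> Obj (groth ?M)"
    "\<And>x y z. \<lbrakk>p = opair x (opair y z); x \<in> Obj (Shape D); y \<in> Obj (Shape (FOb (Fun D) x));
      z \<in> Obj (fibre (FOb (Fun D) x) y)\<rbrakk> \<Longrightarrow> thesis" for p thesis
  proof -
    from that(1) obtain x w where 1: "p = opair x w" "x \<in> Obj (Shape D)" "w \<in> Obj (groth (FOb (Fun D) x))"
      by (auto elim!: groth_objE simp: fibM)
    from this(3) obtain y z where "w = opair y z" "y \<in> Obj (Shape (FOb (Fun D) x))"
      "z \<in> Obj (fibre (FOb (Fun D) x) y)"
      by (auto elim!: groth_objE)
    with 1 that(2) show thesis by blast
  qed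
  \<comment> \<open>The point recorded with the inner arrow is not free: equality of the inner
    domain with the transported \<open>(y, z)\<close> forces it to be the image of \<open>z\<close>
    under the component of \<open>D j\<close> at \<open>y\<close>.\<close>
  have arrE: thesis if "q \<in> Arr (groth ?M)"
    "\<And>y z j k l. \<lbrakk>q = triple (opair y z) j (triple (FOb (MFun (MTrans (FAr (Fun D) j) y)) z) k l);
      j \<in> Arr (Shape D); y \<in> Obj (Shape (FOb (Fun D) (Dom (Shape D) j)));
      z \<in> Obj (fibre (FOb (Fun D) (Dom (Shape D) j)) y);
      k \<in> Arr (Shape (FOb (Fun D) (Cod (Shape D) j)));
      Dom (Shape (FOb (Fun D) (Cod (Shape D) j))) k = FOb (MFun (FAr (Fun D) j)) y;
      l \<in> Arr (fibre (FOb (Fun D) (Cod (Shape D) j)) (Cod (Shape (FOb (Fun D) (Cod (Shape D) j))) k));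
      Dom (fibre (FOb (Fun D) (Cod (Shape D) j)) (Cod (Shape (FOb (Fun D) (Cod (Shape D) j))) k)) l =
        FOb (transport (FOb (Fun D) (Cod (Shape D) j)) k) (FOb (MFun (MTrans (FAr (Fun D) j) y)) z)\<rbrakk>
      \<Longrightarrow> thesis" for q thesis
  proof -
    from that(1) obtain w j v where q: "q = triple w j v" and j: "j \<in> Arr (Shape D)"
      and w: "w \<in> Obj (groth (FOb (Fun D) (Dom (Shape D) j)))"
      and v: "v \<in> Arr (groth (FOb (Fun D) (Cod (Shape D) j)))"
      and eq: "Dom (groth (FOb (Fun D) (Cod (Shape D) j))) v = FOb (MFun (FAr (mu C) (FAr (Fun D) j))) w"
      by (auto elim!: groth_arrE simp: fibM traM)
    from w obtain y z where w: "w = opair y z" "y \<in> Obj (Shape (FOb (Fun D) (Dom (Shape D) j)))"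
      "z \<in> Obj (fibre (FOb (Fun D) (Dom (Shape D) j)) y)" by (auto elim!: groth_objE)
    from v obtain z' k l where v: "v = triple z' k l" "k \<in> Arr (Shape (FOb (Fun D) (Cod (Shape D) j)))"
      "z' \<in> Obj (fibre (FOb (Fun D) (Cod (Shape D) j)) (Dom (Shape (FOb (Fun D) (Cod (Shape D) j))) k))"
      "l \<in> Arr (fibre (FOb (Fun D) (Cod (Shape D) j)) (Cod (Shape (FOb (Fun D) (Cod (Shape D) j))) k))"
      "Dom (fibre (FOb (Fun D) (Cod (Shape D) j)) (Cod (Shape (FOb (Fun D) (Cod (Shape D) j))) k)) l =
        FOb (transport (FOb (Fun D) (Cod (Shape D) j)) k) z'"
      by (auto elim!: groth_arrE)
    have "Dom (Shape (FOb (Fun D) (Cod (Shape D) j))) k = FOb (MFun (FAr (Fun D) j)) y"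
      "z' = FOb (MFun (MTrans (FAr (Fun D) j) y)) z"
      using eq w v D.is_diagram_mor_at[OF j] by simp_all
    with q j w v show thesis by (intro that(2)) auto
  qed
  {
    \<comment> \<open>Facts about the morphism of diagrams of diagrams over a base arrow, exported
      for all base arrows at once; \<open>u\<close> and \<open>v\<close> stand for its endpoints so
      that the facts survive rewriting of these endpoints.\<close>
    fix j u v
    assume j: "j \<in> Arr (Shape D)" and u: "Dom (Shape D) j = u" and v: "Cod (Shape D) j = v"
    interpret m: diagram_of_diagrams_morphism C "FAr (Fun D) j" using j by (rule mor)
    note m.part_simps[unfolded D.is_diagram_mor_at(2,3)[OF j] u v]
      m.transport_natural[unfolded D.is_diagram_mor_at(2,3)[OF j] u v]
      m.R.obj_in[unfolded D.is_diagram_mor_at(2,3)[OF j] u v] m.R.arr_in[unfolded D.is_diagram_mor_at(2,3)[OF j] u v]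
      m.R.dom_arr[unfolded D.is_diagram_mor_at(2,3)[OF j] u v] m.R.cod_arr[unfolded D.is_diagram_mor_at(2,3)[OF j] u v]
  }
  note part [simp] = this
  {
    fix x assume x: "x \<in> Obj (Shape D)"
    interpret x: diagram_of_diagrams C "FOb (Fun D) x" using x by (rule at)
    note x.fibre_simps x.fdiag_simps x.transport_simps x.ftrans_simps x.transport_ide x.transport_comp
      x.I.C.dom_obj x.I.C.cod_obj x.I.C.ide_arr x.I.C.dom_ide x.I.C.cod_ide x.I.C.comp_arr
      x.I.C.dom_comp x.I.C.cod_comp
  }
  note fibre [simp] = this
  \<comment> \<open>By definition of the multiplication, \<open>?N\<close> sends the base arrow
    \<open>(y, j, k)\<close> to the composite in \<open>Diag C\<close> of the arrow at
    \<open>k\<close> after the component of \<open>D j\<close> at \<open>y\<close>. The three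
    equations read off the components of this composite.\<close>
  have traN: "z \<in> Obj (fibre (FOb (Fun D) (Dom (Shape D) j)) y) \<Longrightarrow> FOb (transport ?N (triple y j k)) z =
      FOb (transport (FOb (Fun D) (Cod (Shape D) j)) k) (FOb (MFun (MTrans (FAr (Fun D) j) y)) z)"
    "l \<in> Arr (fibre (FOb (Fun D) (Dom (Shape D) j)) y) \<Longrightarrow> FAr (transport ?N (triple y j k)) l =
      FAr (transport (FOb (Fun D) (Cod (Shape D) j)) k) (FAr (MFun (MTrans (FAr (Fun D) j) y)) l)"
    "z \<in> Obj (fibre (FOb (Fun D) (Dom (Shape D) j)) y) \<Longrightarrow> ftrans ?N (triple y j k) z = Comp C
      (ftrans (FOb (Fun D) (Cod (Shape D) j)) k (FOb (MFun (MTrans (FAr (Fun D) j) y)) z))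
      (MTrans (MTrans (FAr (Fun D) j) y) z)"
    if j: "j \<in> Arr (Shape D)" and y: "y \<in> Obj (Shape (FOb (Fun D) (Dom (Shape D) j)))"
      and k: "k \<in> Arr (Shape (FOb (Fun D) (Cod (Shape D) j)))"
        "Dom (Shape (FOb (Fun D) (Cod (Shape D) j))) k = FOb (MFun (FAr (Fun D) j)) y"
    for y j k z l
  proof -
    interpret m: diagram_of_diagrams_morphism C "FAr (Fun D) j" using j by (rule mor)
    interpret x: diagram_of_diagrams C "FOb (Fun D) (Cod (Shape D) j)" using j by (intro at) simp
    note mj = m.is_diagram_mor_at[unfolded D.is_diagram_mor_at(2,3)[OF j], OF y] x.is_diagram_mor_at[OF k(1)]
    have q: "triple y j k \<in> Arr (groth D)" using j y k by (simp add: fib)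
    have eq: "FAr (Fun ?N) (triple y j k) =
        Comp (Diag C) (FAr (Fun (FOb (Fun D) (Cod (Shape D) j))) k) (MTrans (FAr (Fun D) j) y)"
      by (simp only: mu_obj_sel(3)[OF q] fib)
    show "z \<in> Obj (fibre (FOb (Fun D) (Dom (Shape D) j)) y) \<Longrightarrow> FOb (transport ?N (triple y j k)) z =
      FOb (transport (FOb (Fun D) (Cod (Shape D) j)) k) (FOb (MFun (MTrans (FAr (Fun D) j) y)) z)"
    "l \<in> Arr (fibre (FOb (Fun D) (Dom (Shape D) j)) y) \<Longrightarrow> FAr (transport ?N (triple y j k)) l =
      FAr (transport (FOb (Fun D) (Cod (Shape D) j)) k) (FAr (MFun (MTrans (FAr (Fun D) j) y)) l)"
    "z \<in> Obj (fibre (FOb (Fun D) (Dom (Shape D) j)) y) \<Longrightarrow> ftrans ?N (triple y j k) z = Comp C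
      (ftrans (FOb (Fun D) (Cod (Shape D) j)) k (FOb (MFun (MTrans (FAr (Fun D) j) y)) z))
      (MTrans (MTrans (FAr (Fun D) j) y) z)"
      using mj k(2) by (simp_all add: transport_def ftrans_def fibre_def eq)
  qed
  have "is_functor (groth ?M) (groth ?N) (MFun (assoc_a C D))"
  proof (rule is_functorI, goal_cases)
    case (3 p)
    then show ?case by (rule objE) (simp add: rules C D)
  next
    case (4 q)
    then show ?case by (rule arrE) (simp add: rules traN C D)
  next
    case (5 p)
    have p: "p \<in> Obj (groth ?M)" using 5 by (simp add: C D)
    then obtain x y z where p': "p = opair x (opair y z)" "x \<in> Obj (Shape D)"
      "y \<in> Obj (Shape (FOb (Fun D) x))" "z \<in> Obj (fibre (FOb (Fun D) x) y)"
      by (rule objE)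
    \<comment> \<open>The associator is evaluated only on explicit nested triples known to be
      arrows. The identity is therefore written out, and its membership is inherited from the
      category axioms of the source shape.\<close>
    have eq: "Ide (groth ?M) p = triple (opair y z) (Ide (Shape D) x)
        (triple z (Ide (Shape (FOb (Fun D) x)) y) (Ide (fibre (FOb (Fun D) x) y) z))"
      using p' by (simp add: rules)
    have "triple (opair y z) (Ide (Shape D) x)
        (triple z (Ide (Shape (FOb (Fun D) x)) y) (Ide (fibre (FOb (Fun D) x) y) z)) \<in> Arr (groth ?M)"
      using is_category.ide_arr[OF M.is_category_groth p] by (simp only: eq)
    note image = assoc_a_sel(4)[OF C D this]
    show ?case using p' by (simp add: rules C D eq[unfolded p'] image)
  next
    case (6 q r)
    show ?case using 6(1)
    proof (rule arrE)
      fix y z j k l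
      assume q: "q = triple (opair y z) j (triple (FOb (MFun (MTrans (FAr (Fun D) j) y)) z) k l)"
        "j \<in> Arr (Shape D)" "y \<in> Obj (Shape (FOb (Fun D) (Dom (Shape D) j)))"
        "z \<in> Obj (fibre (FOb (Fun D) (Dom (Shape D) j)) y)"
        "k \<in> Arr (Shape (FOb (Fun D) (Cod (Shape D) j)))"
        "Dom (Shape (FOb (Fun D) (Cod (Shape D) j))) k = FOb (MFun (FAr (Fun D) j)) y"
        "l \<in> Arr (fibre (FOb (Fun D) (Cod (Shape D) j)) (Cod (Shape (FOb (Fun D) (Cod (Shape D) j))) k))"
        "Dom (fibre (FOb (Fun D) (Cod (Shape D) j)) (Cod (Shape (FOb (Fun D) (Cod (Shape D) j))) k)) l =
          FOb (transport (FOb (Fun D) (Cod (Shape D) j)) k) (FOb (MFun (MTrans (FAr (Fun D) j) y)) z)"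
      show ?case using 6(2)
      proof (rule arrE)
        fix y' z' j' k' l'
        assume r: "r = triple (opair y' z') j' (triple (FOb (MFun (MTrans (FAr (Fun D) j') y')) z') k' l')"
          "j' \<in> Arr (Shape D)" "y' \<in> Obj (Shape (FOb (Fun D) (Dom (Shape D) j')))"
          "z' \<in> Obj (fibre (FOb (Fun D) (Dom (Shape D) j')) y')"
          "k' \<in> Arr (Shape (FOb (Fun D) (Cod (Shape D) j')))"
          "Dom (Shape (FOb (Fun D) (Cod (Shape D) j'))) k' = FOb (MFun (FAr (Fun D) j')) y'"
          "l' \<in> Arr (fibre (FOb (Fun D) (Cod (Shape D) j')) (Cod (Shape (FOb (Fun D) (Cod (Shape D) j'))) k'))"
          "Dom (fibre (FOb (Fun D) (Cod (Shape D) j')) (Cod (Shape (FOb (Fun D) (Cod (Shape D) j'))) k')) l' =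
            FOb (transport (FOb (Fun D) (Cod (Shape D) j')) k') (FOb (MFun (MTrans (FAr (Fun D) j') y')) z')"
        have "Cod (groth ?M) q = opair (Cod (Shape D) j) (opair (Cod (Shape (FOb (Fun D) (Cod (Shape D) j))) k)
            (Cod (fibre (FOb (Fun D) (Cod (Shape D) j)) (Cod (Shape (FOb (Fun D) (Cod (Shape D) j))) k)) l))"
          using q by (simp add: rules)
        moreover have "Dom (groth ?M) r = opair (Dom (Shape D) j') (opair y' z')"
          using r by (simp add: rules)
        moreover have "Cod (groth ?M) q = Dom (groth ?M) r" using 6(3) by (simp add: C D)
        ultimately have "opair (Cod (Shape D) j) (opair (Cod (Shape (FOb (Fun D) (Cod (Shape D) j))) k)
            (Cod (fibre (FOb (Fun D) (Cod (Shape D) j)) (Cod (Shape (FOb (Fun D) (Cod (Shape D) j))) k)) l)) =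
          opair (Dom (Shape D) j') (opair y' z')"
          by (simp only:)
        then have "Cod (Shape D) j = Dom (Shape D) j'" "Cod (Shape (FOb (Fun D) (Cod (Shape D) j))) k = y'"
          "Cod (fibre (FOb (Fun D) (Cod (Shape D) j)) (Cod (Shape (FOb (Fun D) (Cod (Shape D) j))) k)) l = z'"
          unfolding opair_inject by blast+
        note eq = this[symmetric]
        \<comment> \<open>The composite \<open>r q\<close> as an explicit nested triple, for the
          same purpose as for identities. The recorded inner starting point is \<open>z\<close>
          carried along \<open>j\<close> and then along \<open>j'\<close>; the innermost slot
          transports \<open>l\<close> first by \<open>j'\<close> and then by
          \<open>k'\<close>.\<close>
        let ?qr = "triple (opair y z) (Comp (Shape D) j' j)
          (triple (FOb (MFun (MTrans (FAr (Fun D) j') (FOb (MFun (FAr (Fun D) j)) y)))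
              (FOb (MFun (MTrans (FAr (Fun D) j) y)) z))
            (Comp (Shape (FOb (Fun D) (Cod (Shape D) j'))) k' (FAr (MFun (FAr (Fun D) j')) k))
            (Comp (fibre (FOb (Fun D) (Cod (Shape D) j')) (Cod (Shape (FOb (Fun D) (Cod (Shape D) j'))) k')) l'
              (FAr (transport (FOb (Fun D) (Cod (Shape D) j')) k')
                 (FAr (MFun (MTrans (FAr (Fun D) j') y')) l))))"
        have qr: "Comp (groth ?M) r q = ?qr"
          using q r by (simp add: eq rules)
        have "?qr \<in> Arr (groth ?M)"
          using is_category.comp_arr[OF M.is_category_groth, of q r] 6 by (simp only: qr assoc_a_sel mu_obj_sel C D)
        note image = assoc_a_sel(4)[OF C D this]
        show ?case using q r eq by (simp add: rules traN C D qr image[unfolded eq])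
      qed
    qed
  qed (use C D M in \<open>simp_all add: M.is_category_groth N.is_category_groth\<close>,
       use M in \<open>simp_all add: assoc_a_def Obj_Diag Let_def\<close>)
  then show ?thesis
  proof (intro is_diagram_morI, goal_cases)
    case (4 p)
    then have "p \<in> Obj (groth ?M)" by (simp add: C D)
    then show ?case by (rule objE) (simp add: rules C D M N)
  next
    case (5 q)
    then have "q \<in> Arr (groth ?M)" by (simp add: C D)
    then show ?case by (rule arrE) (simp add: rules traN C D M N C.comp_comp)
  next
    case 6
    show ?case using C D M by (simp add: assoc_a_def Obj_Diag Let_def)
  qed (use C D M N in \<open>simp_all add: M.is_diagram_mu_obj N.is_diagram_mu_obj\<close>)
qed

section \<open>Sets and disjoint unions\<close>

text \<open>Arrows must be elements of the universe type, so a function is coded by domain, codomain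
  and graph. The codomain is stored because the graph does not determine it; the values of
  \<open>f\<close> outside \<open>elts x\<close> leave no trace.\<close>

definition fn :: "'u::universe \<Rightarrow> ('u \<Rightarrow> 'u) \<Rightarrow> 'u \<Rightarrow> 'u"
  where "fn x f y = opair x (opair y (set_of ((\<lambda>a. opair a (f a)) ` elts x)))"

definition app :: "'u::universe \<Rightarrow> 'u \<Rightarrow> 'u"
  where "app q a = (THE b. opair a b \<in> elts (psnd (psnd q)))"

definition Sets :: "('u::universe, 'u) category"
  where "Sets =
    \<lparr>Obj = UNIV,
     Arr = {fn x f y | x f y. \<forall>a\<in>elts x. f a \<in> elts y},
     Dom = (\<lambda>q\<in>{fn x f y | x f y. \<forall>a\<in>elts x. f a \<in> elts y}. pfst q),
     Cod = (\<lambda>q\<in>{fn x f y | x f y. \<forall>a\<in>elts x. f a \<in> elts y}. pfst (psnd q)),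
     Ide = (\<lambda>x. fn x (\<lambda>a. a) x),
     Comp = (\<lambda>r q.
       if (\<exists>x f y g z. q = fn x f y \<and> r = fn y g z \<and> (\<forall>a\<in>elts x. f a \<in> elts y) \<and> (\<forall>b\<in>elts y. g b \<in> elts z))
       then fn (pfst q) (\<lambda>a. app r (app q a)) (pfst (psnd r))
       else undefined)\<rparr>"

lemma small_elts [simp]: "small (elts x)"
  by (auto simp: small_def)

lemma app_fn [simp]: "a \<in> elts x \<Longrightarrow> app (fn x f y) a = f a"
  using small_image[OF small_elts[of x], of "\<lambda>a. opair a (f a)"]
  by (auto simp: app_def fn_def elts_set_of)

lemma fn_cong: "x = x' \<Longrightarrow> y = y' \<Longrightarrow> (\<And>a. a \<in> elts x \<Longrightarrow> f a = g a) \<Longrightarrow> fn x f y = fn x' g y'"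
  by (auto simp: fn_def cong: image_cong)

lemma fn_sel [simp]: "pfst (fn x f y) = x" "pfst (psnd (fn x f y)) = y"
  by (simp_all add: fn_def)

lemma Obj_Sets [simp]: "x \<in> Obj Sets"
  by (simp add: Sets_def)

lemma fn_arr [simp]:
  assumes "\<And>a. a \<in> elts x \<Longrightarrow> f a \<in> elts y"
  shows "fn x f y \<in> Arr Sets" "Dom Sets (fn x f y) = x" "Cod Sets (fn x f y) = y"
proof -
  show *: "fn x f y \<in> Arr Sets" using assms by (auto simp: Sets_def)
  then show "Dom Sets (fn x f y) = x" "Cod Sets (fn x f y) = y"
    by (simp_all add: Sets_def)
qed

lemma Sets_arrE:
  assumes "q \<in> Arr Sets"
  obtains x f y where "q = fn x f y" "\<And>a. a \<in> elts x \<Longrightarrow> f a \<in> elts y"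
  using assms by (auto simp: Sets_def)

lemma app_in: "q \<in> Arr Sets \<Longrightarrow> a \<in> elts (Dom Sets q) \<Longrightarrow> app q a \<in> elts (Cod Sets q)"
  by (erule Sets_arrE) simp

text \<open>The principle behind every equation of functions below: arrows with the same endpoints
  are compared on elements, which reduces naturality and coherence to bookkeeping with nested
  pairs.\<close>

lemma Sets_arr_eqI:
  assumes "q \<in> Arr Sets" "r \<in> Arr Sets" "Dom Sets q = Dom Sets r" "Cod Sets q = Cod Sets r"
    and "\<And>a. a \<in> elts (Dom Sets q) \<Longrightarrow> app q a = app r a"
  shows "q = r"
  using assms by (elim Sets_arrE) (auto intro!: fn_cong)

lemma Comp_Sets:
  assumes "q \<in> Arr Sets" "r \<in> Arr Sets" "Cod Sets q = Dom Sets r"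
  shows "Comp Sets r q = fn (Dom Sets q) (\<lambda>a. app r (app q a)) (Cod Sets r)"
proof -
  obtain x f y where q: "q = fn x f y" "\<And>a. a \<in> elts x \<Longrightarrow> f a \<in> elts y"
    using assms(1) by (auto elim: Sets_arrE)
  obtain y' g z where r: "r = fn y' g z" "\<And>a. a \<in> elts y' \<Longrightarrow> g a \<in> elts z"
    using assms(2) by (auto elim: Sets_arrE)
  have eq: "y' = y" using assms(3) q r by simp
  have "\<exists>x' f' w g' z'. q = fn x' f' w \<and> r = fn w g' z' \<and>
      (\<forall>a\<in>elts x'. f' a \<in> elts w) \<and> (\<forall>b\<in>elts w. g' b \<in> elts z')"
    using q r eq by blast
  then have "Comp Sets r q = fn (pfst q) (\<lambda>a. app r (app q a)) (pfst (psnd r))"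
    by (simp add: Sets_def)
  also have "pfst q = Dom Sets q" using q by simp
  also have "pfst (psnd r) = Cod Sets r" using r by simp
  finally show ?thesis .
qed

lemma Comp_Sets_simps [simp]:
  assumes "q \<in> Arr Sets" "r \<in> Arr Sets" "Cod Sets q = Dom Sets r"
  shows "Comp Sets r q \<in> Arr Sets" "Dom Sets (Comp Sets r q) = Dom Sets q"
    "Cod Sets (Comp Sets r q) = Cod Sets r"
    "a \<in> elts (Dom Sets q) \<Longrightarrow> app (Comp Sets r q) a = app r (app q a)"
  using app_in[OF assms(1)] app_in[OF assms(2)] assms(3) by (simp_all add: Comp_Sets[OF assms])

lemma Ide_Sets [simp]:
  "Ide Sets x \<in> Arr Sets" "Dom Sets (Ide Sets x) = x" "Cod Sets (Ide Sets x) = x"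
  "a \<in> elts x \<Longrightarrow> app (Ide Sets x) a = a"
proof -
  have "Ide Sets x = fn x (\<lambda>a. a) x" by (simp add: Sets_def)
  then show "Ide Sets x \<in> Arr Sets" "Dom Sets (Ide Sets x) = x" "Cod Sets (Ide Sets x) = x"
    "a \<in> elts x \<Longrightarrow> app (Ide Sets x) a = a" by simp_all
qed

lemma is_category_Sets: "is_category Sets"
proof (rule is_categoryI, goal_cases)
  case (5 q)
  show ?case by (rule Sets_arr_eqI) (use 5 in auto)
next
  case (6 q)
  show ?case by (rule Sets_arr_eqI) (use 6 in \<open>auto simp: app_in\<close>)
next
  case (7 q r s)
  have *: "app q a \<in> elts (Dom Sets r)" if "a \<in> elts (Dom Sets q)" for a
    using app_in[OF 7(1) that] 7 by simp
  show ?case by (rule Sets_arr_eqI) (use 7 * in auto)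
next
  case (11 q r)
  show ?case
  proof (rule ccontr)
    assume "Comp Sets r q \<noteq> undefined"
    then obtain x f y g z where "q = fn x f y" "r = fn y g z" "\<forall>a\<in>elts x. f a \<in> elts y"
        "\<forall>b\<in>elts y. g b \<in> elts z"
      by (auto simp: Sets_def split: if_splits)
    then show False using 11 by simp
  qed
qed (auto, auto simp: Sets_def)

text \<open>A function from \<open>x\<close> to \<open>y\<close> is determined by its graph, a
  subset of the product \<open>p\<close> of \<open>x\<close> and \<open>y\<close>; power set and
  replacement bound the codes.\<close>

lemma locally_small_Sets: "locally_small Sets"
  unfolding locally_small_def
proof (intro ballI)
  fix x y :: 'a
  have "small (\<Union>a\<in>elts x. opair a ` elts y)"
    by (intro small_UN small_image small_elts)
  then obtain p where p: "elts p = (\<Union>a\<in>elts x. opair a ` elts y)"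
    by (auto simp: small_def)
  have "small {g. elts g \<subseteq> elts p}" using power_set by (simp add: small_def)
  then have "small ((\<lambda>g. opair x (opair y g)) ` {g. elts g \<subseteq> elts p})"
    by (rule small_image)
  moreover have "Hom Sets x y \<subseteq> (\<lambda>g. opair x (opair y g)) ` {g. elts g \<subseteq> elts p}"
  proof
    fix q assume "q \<in> Hom Sets x y"
    then have "q \<in> Arr Sets" and st: "Dom Sets q = x" "Cod Sets q = y" by (auto simp: Hom_iff)
    then obtain x' f y' where "q = fn x' f y'" "\<And>a. a \<in> elts x' \<Longrightarrow> f a \<in> elts y'"
      by (auto elim: Sets_arrE)
    with st have q: "q = fn x f y" and f: "\<And>a. a \<in> elts x \<Longrightarrow> f a \<in> elts y" by simp_all
    have "elts (set_of ((\<lambda>a. opair a (f a)) ` elts x)) \<subseteq> elts p"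
      using f by (auto simp: elts_set_of small_image p)
    then show "q \<in> (\<lambda>g. opair x (opair y g)) ` {g. elts g \<subseteq> elts p}"
      unfolding q fn_def by blast
  qed
  ultimately show "small (Hom Sets x y)" by (rule small_subset)
qed

lemma iso_in_Sets:
  assumes "\<And>a. a \<in> elts x \<Longrightarrow> f a \<in> elts y \<and> g (f a) = a"
    and "\<And>b. b \<in> elts y \<Longrightarrow> g b \<in> elts x \<and> f (g b) = b"
  shows "iso_in Sets (fn x f y)"
proof -
  have "fn y g x \<in> Hom Sets y x" using assms by (simp add: Hom_iff)
  moreover have "Comp Sets (fn y g x) (fn x f y) = Ide Sets x"
    by (rule Sets_arr_eqI) (use assms in auto)
  moreover have "Comp Sets (fn x f y) (fn y g x) = Ide Sets y"
    by (rule Sets_arr_eqI) (use assms in auto)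
  ultimately show ?thesis using assms unfolding iso_in_def by auto
qed

section \<open>The disjoint union functor\<close>

definition coproduct :: "('u::universe, 'u, 'u) diagram \<Rightarrow> 'u"
  where "coproduct D = set_of (\<Union>j\<in>Obj (Shape D). opair j ` elts (FOb (Fun D) j))"

definition coproduct_functor :: "(('u::universe, 'u, 'u) diagram, ('u, 'u, 'u) diagram_mor, 'u, 'u) cfunctor"
  where "coproduct_functor =
    \<lparr>FOb = (\<lambda>D\<in>Obj (Diag Sets). coproduct D),
     FAr = (\<lambda>m\<in>Arr (Diag Sets). fn (coproduct (Src m))
       (\<lambda>p. opair (FOb (MFun m) (pfst p)) (app (MTrans m (pfst p)) (psnd p))) (coproduct (Tgt m)))\<rparr>"

definition coproduct_unit :: "'u::universe \<Rightarrow> 'u"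
  where "coproduct_unit = (\<lambda>x\<in>Obj Sets. fn (coproduct (point Sets x)) psnd x)"

definition coproduct_assoc :: "('u::universe, 'u, 'u) diagram2 \<Rightarrow> 'u"
  where "coproduct_assoc = (\<lambda>D\<in>Obj (Diag (Diag Sets)).
    fn (coproduct (push_diagram coproduct_functor D))
      (\<lambda>p. opair (opair (pfst p) (pfst (psnd p))) (psnd (psnd p)))
      (coproduct (mu_obj Sets D)))"

lemma elts_coproduct:
  assumes "is_diagram C D"
  shows "elts (coproduct D) = (\<Union>j\<in>Obj (Shape D). opair j ` elts (FOb (Fun D) j))"
proof -
  have "small (Obj (Shape D))" using diagram_small[OF assms] by (simp add: small_category_def)
  then show ?thesis unfolding coproduct_def
    by (intro elts_set_of small_UN small_image small_elts)
qed

lemma coproduct_iff [simp]: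
  "is_diagram Sets D \<Longrightarrow>
    opair j a \<in> elts (coproduct D) \<longleftrightarrow> j \<in> Obj (Shape D) \<and> a \<in> elts (FOb (Fun D) j)"
  by (auto simp: elts_coproduct)

lemma coproductE:
  assumes "p \<in> elts (coproduct D)" "is_diagram Sets D"
  obtains j a where "p = opair j a" "j \<in> Obj (Shape D)" "a \<in> elts (FOb (Fun D) j)"
  using assms by (auto simp: elts_coproduct)

lemma FOb_coproduct_functor [simp]:
  "is_diagram Sets D \<Longrightarrow> FOb coproduct_functor D = coproduct D"
  by (simp add: coproduct_functor_def Obj_Diag)

lemma coproduct_functor_arr [simp]:
  assumes "is_diagram_mor Sets m"
  shows "FAr coproduct_functor m \<in> Arr Sets" "Dom Sets (FAr coproduct_functor m) = coproduct (Src m)"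
    "Cod Sets (FAr coproduct_functor m) = coproduct (Tgt m)"
    "j \<in> Obj (Shape (Src m)) \<Longrightarrow> a \<in> elts (FOb (Fun (Src m)) j) \<Longrightarrow>
      app (FAr coproduct_functor m) (opair j a) = opair (FOb (MFun m) j) (app (MTrans m j) a)"
proof -
  interpret m: diagram_morphism Sets m by unfold_locales fact
  let ?f = "\<lambda>p. opair (FOb (MFun m) (pfst p)) (app (MTrans m (pfst p)) (psnd p))"
  have eq: "FAr coproduct_functor m = fn (coproduct (Src m)) ?f (coproduct (Tgt m))"
    using assms by (simp add: coproduct_functor_def Arr_Diag)
  note st = diagram_mor_src[OF assms] diagram_mor_tgt[OF assms]
  have "?f p \<in> elts (coproduct (Tgt m))" if "p \<in> elts (coproduct (Src m))" for p
    using that st(1)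
  proof (rule coproductE)
    fix j a assume "p = opair j a" "j \<in> Obj (Shape (Src m))" "a \<in> elts (FOb (Fun (Src m)) j)"
    then show ?thesis using st app_in[of "MTrans m j" a] by simp
  qed
  then show "FAr coproduct_functor m \<in> Arr Sets" "Dom Sets (FAr coproduct_functor m) = coproduct (Src m)"
    "Cod Sets (FAr coproduct_functor m) = coproduct (Tgt m)" by (simp_all add: eq)
  show "j \<in> Obj (Shape (Src m)) \<Longrightarrow> a \<in> elts (FOb (Fun (Src m)) j) \<Longrightarrow>
      app (FAr coproduct_functor m) (opair j a) = opair (FOb (MFun m) j) (app (MTrans m j) a)"
    using st by (simp add: eq)
qed

text \<open>For composites: the first map leaves an element tagged by \<open>FOb (MFun m) j\<close>,
  and composition in \<open>Diag\<close> takes the component of \<open>n\<close> at exactly that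
  object.\<close>

lemma is_functor_coproduct: "is_functor (Diag Sets) Sets coproduct_functor"
proof (rule is_functorI, goal_cases)
  case (5 D)
  then have D: "is_diagram Sets D" by (simp add: Obj_Diag)
  then have i: "is_diagram_mor Sets (Ide (Diag Sets) D)"
    by (simp add: is_diagram_mor_ide is_category_Sets)
  interpret D: is_functor "Shape D" Sets "Fun D" using D by (rule diagram_functor)
  show ?case
  proof (rule Sets_arr_eqI)
    fix p assume "p \<in> elts (Dom Sets (FAr coproduct_functor (Ide (Diag Sets) D)))"
    then have "p \<in> elts (coproduct D)" using D i by simp
    then show "app (FAr coproduct_functor (Ide (Diag Sets) D)) p = app (Ide Sets (FOb coproduct_functor D)) p"
      using D by (rule coproductE) (use D i in simp)
  qed (use D i in simp_all)
next
  case (6 m n)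
  then have m: "is_diagram_mor Sets m" "is_diagram_mor Sets n" and eq: "Src n = Tgt m"
    by (simp_all add: Arr_Diag)
  interpret m: diagram_morphism Sets m by unfold_locales fact
  interpret n: diagram_morphism Sets n by unfold_locales fact
  have mem: "app (MTrans m j) a \<in> elts (FOb (Fun (Tgt m)) (FOb (MFun m) j))"
    if "j \<in> Obj (Shape (Src m))" "a \<in> elts (FOb (Fun (Src m)) j)" for j a
    using app_in[of "MTrans m j" a] that by simp
  have c: "is_diagram_mor Sets (Comp (Diag Sets) n m)"
    using m eq by (simp add: is_diagram_mor_comp is_category_Sets)
  show ?case
  proof (rule Sets_arr_eqI)
    fix p assume "p \<in> elts (Dom Sets (FAr coproduct_functor (Comp (Diag Sets) n m)))"
    then have "p \<in> elts (coproduct (Src m))" using c m eq by simp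
    then show "app (FAr coproduct_functor (Comp (Diag Sets) n m)) p =
        app (Comp Sets (FAr coproduct_functor n) (FAr coproduct_functor m)) p"
      using diagram_mor_src[OF m(1)]
      by (rule coproductE) (use m eq c mem in \<open>simp add: diagram_mor_src\<close>)
  qed (use m eq c in simp_all)
qed (auto simp: is_category_Diag is_category_Sets Arr_Diag Obj_Diag diagram_mor_src diagram_mor_tgt,
     auto simp: coproduct_functor_def)

section \<open>The unit isomorphism\<close>

lemma is_diagram_point_Sets [simp]: "is_diagram Sets (point Sets x)"
  by (simp add: is_diagram_point is_category_Sets)

lemma coproduct_unit_arr [simp]:
  "coproduct_unit x \<in> Arr Sets" "Dom Sets (coproduct_unit x) = coproduct (point Sets x)"
  "Cod Sets (coproduct_unit x) = x" "a \<in> elts x \<Longrightarrow> app (coproduct_unit x) (opair pt a) = a"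
proof -
  have "psnd p \<in> elts x" if "p \<in> elts (coproduct (point Sets x))" for p
    using that by (rule coproductE) auto
  then show "coproduct_unit x \<in> Arr Sets" "Dom Sets (coproduct_unit x) = coproduct (point Sets x)"
    "Cod Sets (coproduct_unit x) = x" "a \<in> elts x \<Longrightarrow> app (coproduct_unit x) (opair pt a) = a"
    by (simp_all add: coproduct_unit_def)
qed

lemma nat_iso_coproduct_unit:
  "nat_iso (Sets :: ('u::universe, 'u) category) Sets (fcomp Sets coproduct_functor (eta Sets)) (id_functor Sets) coproduct_unit"
  unfolding nat_iso_def
proof
  note eta_functor = is_functor_eta[OF is_category_Sets] and cat = is_category_Sets
  show "nat_trans (Sets :: ('u, 'u) category) Sets (fcomp Sets coproduct_functor (eta Sets)) (id_functor Sets) coproduct_unit"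
  proof (rule nat_transI, goal_cases)
    case (4 f)
    have m: "is_diagram_mor Sets (FAr (eta Sets) f :: ('u, 'u, 'u) diagram_mor)"
      using is_category_Sets 4 by (rule is_diagram_mor_eta)
    show ?case
    proof (rule Sets_arr_eqI)
      fix p assume "p \<in> elts (Dom Sets (Comp Sets (coproduct_unit (Cod Sets f))
          (FAr (fcomp Sets coproduct_functor (eta Sets)) f)))"
      then have "p \<in> elts (coproduct (point Sets (Dom Sets f)))" using 4 m by simp
      then show "app (Comp Sets (coproduct_unit (Cod Sets f))
            (FAr (fcomp Sets coproduct_functor (eta Sets)) f)) p =
          app (Comp Sets (FAr (id_functor Sets) f) (coproduct_unit (Dom Sets f))) p"
        by (rule coproductE) (use 4 m in \<open>simp_all add: app_in\<close>)
    qed (use 4 m in simp_all)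
  qed (use eta_functor is_functor_coproduct cat in auto, simp add: coproduct_unit_def)
  show "\<forall>x\<in>Obj (Sets :: ('u, 'u) category). iso_in Sets (coproduct_unit x)"
  proof
    fix x :: 'u
    have "iso_in Sets (fn (coproduct (point Sets x)) psnd x)"
      by (rule iso_in_Sets[where g = "opair pt"]) (auto elim: coproductE)
    then show "iso_in Sets (coproduct_unit x)" by (simp add: coproduct_unit_def)
  qed
qed

section \<open>The associativity isomorphism\<close>

lemma is_diagram_push_coproduct: "is_diagram (Diag Sets) D \<Longrightarrow> is_diagram Sets (push_diagram coproduct_functor D)"
  using is_functor_coproduct by (rule is_diagram_push)

lemma is_diagram_mu_Sets: "is_diagram (Diag Sets) D \<Longrightarrow> is_diagram Sets (mu_obj Sets D)"
  using is_category_Sets by (intro diagram_of_diagrams.is_diagram_mu_obj diagram_of_diagrams.intro)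

lemma diagram_of_diagrams_Sets: "is_diagram (Diag Sets) D \<Longrightarrow> diagram_of_diagrams Sets D"
  using is_category_Sets by (rule diagram_of_diagrams.intro)

lemma coproduct_push_iff [simp]:
  assumes D: "is_diagram (Diag Sets) D"
  shows "opair j (opair x a) \<in> elts (coproduct (push_diagram coproduct_functor D)) \<longleftrightarrow>
    j \<in> Obj (Shape D) \<and> x \<in> Obj (fibre D j) \<and> a \<in> elts (FOb (fdiag D j) x)"
proof -
  interpret diagram_of_diagrams Sets D using D by (rule diagram_of_diagrams_Sets)
  show ?thesis using is_diagram_at is_diagram_push_coproduct[OF D]
    by (auto simp: fibre_def fdiag_def)
qed

lemma coproduct_pushE:
  assumes "p \<in> elts (coproduct (push_diagram coproduct_functor D))" and D: "is_diagram (Diag Sets) D"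
  obtains j x a where "p = opair j (opair x a)" "j \<in> Obj (Shape D)" "x \<in> Obj (fibre D j)"
    "a \<in> elts (FOb (fdiag D j) x)"
proof -
  interpret diagram_of_diagrams Sets D using D by (rule diagram_of_diagrams_Sets)
  obtain j b where p: "p = opair j b" "j \<in> Obj (Shape D)" "b \<in> elts (coproduct (FOb (Fun D) j))"
    using assms(1) is_diagram_push_coproduct[OF D] by (rule coproductE) (simp add: is_diagram_at)
  from p(3) is_diagram_at[OF p(2)] obtain x a where "b = opair x a" "x \<in> Obj (fibre D j)"
    "a \<in> elts (FOb (fdiag D j) x)"
    unfolding fibre_def fdiag_def by (rule coproductE)
  with p that show thesis by blast
qed

text \<open>The condition on \<open>j\<close>, \<open>x\<close>, \<open>a\<close> is the same as in
  \<open>coproduct_push_iff\<close>, which is why moving the brackets is a bijection between the two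
  disjoint unions.\<close>

lemma coproduct_mu_iff [simp]:
  assumes D: "is_diagram (Diag Sets) D"
  shows "opair (opair j x) a \<in> elts (coproduct (mu_obj Sets D)) \<longleftrightarrow>
    j \<in> Obj (Shape D) \<and> x \<in> Obj (fibre D j) \<and> a \<in> elts (FOb (fdiag D j) x)"
  using is_diagram_mu_Sets[OF D] by auto

lemma coproduct_muE:
  assumes "p \<in> elts (coproduct (mu_obj Sets D))" and D: "is_diagram (Diag Sets) D"
  obtains j x a where "p = opair (opair j x) a" "j \<in> Obj (Shape D)" "x \<in> Obj (fibre D j)"
    "a \<in> elts (FOb (fdiag D j) x)"
  using assms(1) is_diagram_mu_Sets[OF D]
  by (rule coproductE) (use that in \<open>auto elim!: groth_objE\<close>)

lemma coproduct_assoc_arr [simp]: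
  assumes D: "is_diagram (Diag Sets) D"
  shows "coproduct_assoc D \<in> Arr Sets"
    "Dom Sets (coproduct_assoc D) = coproduct (push_diagram coproduct_functor D)"
    "Cod Sets (coproduct_assoc D) = coproduct (mu_obj Sets D)"
    "j \<in> Obj (Shape D) \<Longrightarrow> x \<in> Obj (fibre D j) \<Longrightarrow> a \<in> elts (FOb (fdiag D j) x) \<Longrightarrow>
      app (coproduct_assoc D) (opair j (opair x a)) = opair (opair j x) a"
proof -
  let ?f = "\<lambda>p. opair (opair (pfst p) (pfst (psnd p))) (psnd (psnd p))"
  have eq: "coproduct_assoc D = fn (coproduct (push_diagram coproduct_functor D)) ?f (coproduct (mu_obj Sets D))"
    using D by (simp add: coproduct_assoc_def Obj_Diag)
  have "?f p \<in> elts (coproduct (mu_obj Sets D))"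
    if "p \<in> elts (coproduct (push_diagram coproduct_functor D))" for p
    using that D by (rule coproduct_pushE) (use D in simp)
  then show "coproduct_assoc D \<in> Arr Sets"
    "Dom Sets (coproduct_assoc D) = coproduct (push_diagram coproduct_functor D)"
    "Cod Sets (coproduct_assoc D) = coproduct (mu_obj Sets D)"
    "j \<in> Obj (Shape D) \<Longrightarrow> x \<in> Obj (fibre D j) \<Longrightarrow> a \<in> elts (FOb (fdiag D j) x) \<Longrightarrow>
      app (coproduct_assoc D) (opair j (opair x a)) = opair (opair j x) a"
    using D by (simp_all add: eq)
qed

lemma nat_iso_coproduct_assoc:
  "nat_iso (Diag (Diag Sets)) Sets
    (fcomp (Diag (Diag Sets)) coproduct_functor (push (Diag Sets) coproduct_functor))
    (fcomp (Diag (Diag Sets)) coproduct_functor (mu Sets)) coproduct_assoc"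
  (is "nat_iso ?DD Sets ?F ?G _")
  unfolding nat_iso_def
proof
  note fs = is_functor_fcomp[OF is_functor_push[OF is_functor_coproduct] is_functor_coproduct]
    is_functor_fcomp[OF is_functor_mu[OF is_category_Sets] is_functor_coproduct]
  show "nat_trans ?DD Sets ?F ?G coproduct_assoc"
  proof (rule nat_transI, goal_cases)
    case (3 D)
    then show ?case by (simp add: Obj_Diag is_diagram_push_coproduct is_diagram_mu_Sets)
  next
    case (4 m)
    then have m: "is_diagram_mor (Diag Sets) m" by (simp add: Arr_Diag)
    interpret diagram_of_diagrams_morphism Sets m
      using is_category_Sets m by (rule diagram_of_diagrams_morphism.intro)
    note st = diagram_mor_src[OF m] diagram_mor_tgt[OF m]
    have p: "is_diagram_mor Sets (FAr (push (Diag Sets) coproduct_functor) m)"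
      using is_functor_coproduct m by (rule is_diagram_mor_push)
    have mem: "app (MTrans (MTrans m j) x) a \<in>
        elts (FOb (fdiag (Tgt m) (FOb (MFun m) j)) (FOb (MFun (MTrans m j)) x))"
      if "j \<in> Obj (Shape (Src m))" "x \<in> Obj (fibre (Src m) j)" "a \<in> elts (FOb (fdiag (Src m) j) x)"
      for j x a
      using app_in[of "MTrans (MTrans m j) x" a] that by simp
    show ?case
    proof (rule Sets_arr_eqI)
      fix q assume "q \<in> elts (Dom Sets (Comp Sets (coproduct_assoc (Cod ?DD m)) (FAr ?F m)))"
      then have "q \<in> elts (coproduct (push_diagram coproduct_functor (Src m)))"
        using 4 m p st by simp
      then show "app (Comp Sets (coproduct_assoc (Cod ?DD m)) (FAr ?F m)) q =
          app (Comp Sets (FAr ?G m) (coproduct_assoc (Dom ?DD m))) q"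
        using st(1)
      proof (rule coproduct_pushE)
        fix j x a
        assume q: "q = opair j (opair x a)" "j \<in> Obj (Shape (Src m))" "x \<in> Obj (fibre (Src m) j)"
          "a \<in> elts (FOb (fdiag (Src m) j) x)"
        \<comment> \<open>Evaluation in two layers: the outer disjoint union moves the tag
          \<open>j\<close> and applies the function induced by \<open>MTrans m j\<close>, which in
          turn moves the tag \<open>x\<close> and applies the innermost component to
          \<open>a\<close>.\<close>
        have "app (FAr coproduct_functor (FAr (push (Diag Sets) coproduct_functor) m)) q =
            opair (FOb (MFun m) j) (app (FAr coproduct_functor (MTrans m j)) (opair x a))"
          using q m p S.is_diagram_at[OF q(2)] by (simp add: fibre_def fdiag_def)
        also have "app (FAr coproduct_functor (MTrans m j)) (opair x a) =
            opair (FOb (MFun (MTrans m j)) x) (app (MTrans (MTrans m j) x) a)"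
          using q is_diagram_mor_at[OF q(2)] by (simp add: fibre_def fdiag_def)
        finally show ?thesis
          using q 4 m p st mem is_diagram_mor_mu by simp
      qed
    qed (use 4 m p st is_diagram_mor_mu in simp_all)
  qed (use fs in \<open>simp_all add: coproduct_assoc_def\<close>)
  show "\<forall>D\<in>Obj ?DD. iso_in Sets (coproduct_assoc D)"
  proof
    fix D assume "D \<in> Obj ?DD"
    then have D: "is_diagram (Diag Sets) D" by (simp add: Obj_Diag)
    have "iso_in Sets (fn (coproduct (push_diagram coproduct_functor D))
        (\<lambda>p. opair (opair (pfst p) (pfst (psnd p))) (psnd (psnd p))) (coproduct (mu_obj Sets D)))"
      by (rule iso_in_Sets[where g = "\<lambda>p. opair (pfst (pfst p)) (opair (psnd (pfst p)) (psnd p))"])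
        (use D in \<open>auto elim!: coproduct_pushE coproduct_muE\<close>)
    then show "iso_in Sets (coproduct_assoc D)" using D by (simp add: coproduct_assoc_def Obj_Diag)
  qed
qed

section \<open>The coherence laws\<close>

lemma nat_iso_nat_trans: "nat_iso C D F G \<alpha> \<Longrightarrow> nat_trans C D F G \<alpha>"
  by (simp add: nat_iso_def)

text \<open>Both sides send \<open>(j, (pt, a))\<close> to \<open>((j, pt), a)\<close>: the left
  moves the brackets, while on the right the unit isomorphism deletes \<open>pt\<close> and the
  unitor puts it back next to \<open>j\<close>.\<close>

lemma coproduct_unit_law:
  assumes D: "is_diagram Sets D"
  shows "coproduct_assoc (push_diagram (eta Sets) D) =
    Comp Sets (FAr coproduct_functor (unitor_r Sets D))
      (FAr coproduct_functor
        (push_nt Sets (fcomp Sets coproduct_functor (eta Sets)) (id_functor Sets) coproduct_unit D))"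
    (is "coproduct_assoc ?E = Comp Sets (FAr _ ?r) (FAr _ ?n)")
proof -
  have E: "is_diagram (Diag Sets) ?E"
    using is_functor_eta[OF is_category_Sets] D by (rule is_diagram_push)
  have fib [simp]: "fibre ?E j = one" "FOb (fdiag ?E j) pt = FOb (Fun D) j" if "j \<in> Obj (Shape D)" for j
    using that by (simp_all add: fibre_def fdiag_def)
  have r: "is_diagram_mor Sets ?r" using is_category_Sets D by (rule is_diagram_mor_unitor_r)
  have n: "is_diagram_mor Sets ?n"
    by (rule is_diagram_mor_push_nt[OF nat_iso_nat_trans[OF nat_iso_coproduct_unit] D])
  have src: "Src ?n = push_diagram coproduct_functor ?E" and tgt: "Tgt ?n = D"
    using D by (simp_all add: push_diagram_fcomp)
  have tgt_r: "Tgt ?r = mu_obj Sets ?E" using D E by simp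
  show ?thesis
  proof (rule Sets_arr_eqI)
    fix p assume "p \<in> elts (Dom Sets (coproduct_assoc ?E))"
    then have "p \<in> elts (coproduct (push_diagram coproduct_functor ?E))" using E by simp
    then show "app (coproduct_assoc ?E) p =
        app (Comp Sets (FAr coproduct_functor ?r) (FAr coproduct_functor ?n)) p"
      using E
    proof (rule coproduct_pushE)
      fix j x a
      assume p: "p = opair j (opair x a)" "j \<in> Obj (Shape ?E)" "x \<in> Obj (fibre ?E j)"
        "a \<in> elts (FOb (fdiag ?E j) x)"
      then have j: "j \<in> Obj (Shape D)" and x: "x = pt" and a: "a \<in> elts (FOb (Fun D) j)" by auto
      have "app (FAr coproduct_functor ?n) p = opair j (app (coproduct_unit (FOb (Fun D) j)) (opair pt a))"
        using n j x a p(1) D by simp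
      also have "\<dots> = opair j a" using a by simp
      finally have 1: "app (FAr coproduct_functor ?n) p = opair j a" .
      have 2: "app (FAr coproduct_functor ?r) (opair j a) = opair (opair j pt) a"
        using r j a D by simp
      have "app (Comp Sets (FAr coproduct_functor ?r) (FAr coproduct_functor ?n)) p = opair (opair j pt) a"
        using p r n src tgt tgt_r 1 2 E D by (subst Comp_Sets_simps) simp_all
      then show ?thesis using p E j x a by simp
    qed
  qed (use E r n src tgt tgt_r D in simp_all)
qed

text \<open>Both sides send \<open>(j, (k, (l, c)))\<close> to \<open>(((j, k), l), c)\<close>. The
  left passes through \<open>(j, ((k, l), c))\<close> and \<open>((j, (k, l)), c)\<close>, the right
  through \<open>((j, k), (l, c))\<close>.\<close>

lemma coproduct_assoc_law:
  fixes D :: "('u::universe, ('u, 'u, 'u) diagram, ('u, 'u, 'u) diagram_mor) diagram2"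
  assumes D: "is_diagram (Diag (Diag Sets)) D"
  shows "Comp Sets (FAr coproduct_functor (assoc_a Sets D))
      (Comp Sets (coproduct_assoc (push_diagram (mu Sets) D))
        (FAr coproduct_functor (push_nt (Diag (Diag Sets))
          (fcomp (Diag (Diag Sets)) coproduct_functor (push (Diag Sets) coproduct_functor))
          (fcomp (Diag (Diag Sets)) coproduct_functor (mu Sets)) coproduct_assoc D))) =
    Comp Sets (coproduct_assoc (mu_obj (Diag Sets) D))
      (coproduct_assoc (push_diagram (push (Diag Sets) coproduct_functor) D))"
    (is "Comp Sets (FAr _ ?a) (Comp Sets (coproduct_assoc ?M) (FAr _ ?n)) =
      Comp Sets (coproduct_assoc ?N) (coproduct_assoc ?P)")
proof -
  let ?e = "coproduct_functor"
  interpret D: diagram_of_diagrams "Diag Sets" D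
    using is_category_Diag[OF is_category_Sets] D by (rule diagram_of_diagrams.intro)
  have a: "is_diagram_mor Sets ?a" using is_category_Sets D by (rule is_diagram_mor_assoc_a)
  have n: "is_diagram_mor Sets ?n"
    by (rule is_diagram_mor_push_nt[OF nat_iso_nat_trans[OF nat_iso_coproduct_assoc] D])
  have M: "is_diagram (Diag Sets) ?M" using is_functor_mu[OF is_category_Sets] D by (rule is_diagram_push)
  have N: "is_diagram (Diag Sets) ?N" by (rule D.is_diagram_mu_obj)
  have P: "is_diagram (Diag Sets) ?P"
    using is_functor_push[OF is_functor_coproduct] D by (rule is_diagram_push)
  have at: "is_diagram (Diag Sets) (FOb (Fun D) j)" if "j \<in> Obj (Shape D)" for j
    using D.is_diagram_at[OF that] .
  have at2: "is_diagram Sets (FOb (Fun (FOb (Fun D) j)) k)"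
    if "j \<in> Obj (Shape D)" "k \<in> Obj (Shape (FOb (Fun D) j))" for j k
    using diagram_of_diagrams.is_diagram_at[OF diagram_of_diagrams_Sets[OF at]] that by blast
  have src: "Src ?n = push_diagram ?e ?P" and tgt: "Tgt ?n = push_diagram ?e ?M"
    using D by (simp_all add: push_diagram_fcomp)
  have src_a: "Src ?a = mu_obj Sets ?M" and tgt_a: "Tgt ?a = mu_obj Sets ?N"
    using D by (simp_all add: is_category_Sets)
  have fibM: "fibre ?M j = groth (FOb (Fun D) j)" "fdiag ?M j = Fun (mu_obj Sets (FOb (Fun D) j))"
    if "j \<in> Obj (Shape D)" for j
    using that at[OF that] by (simp_all add: fibre_def fdiag_def)
  have fibN: "fibre ?N (opair j k) = fibre (FOb (Fun D) j) k"
    "fdiag ?N (opair j k) = fdiag (FOb (Fun D) j) k"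
    if "j \<in> Obj (Shape D)" "k \<in> Obj (Shape (FOb (Fun D) j))" for j k
    using that by (simp_all add: fibre_def fdiag_def)
  have fibP: "fibre ?P j = Shape (FOb (Fun D) j)" if "j \<in> Obj (Shape D)" for j
    using that at[OF that] by (simp add: fibre_def)
  have fdiagP: "FOb (fdiag ?P j) k = coproduct (FOb (Fun (FOb (Fun D) j)) k)"
    if "j \<in> Obj (Shape D)" "k \<in> Obj (Shape (FOb (Fun D) j))" for j k
    using that at at2 by (simp add: fdiag_def)
  have iff: "opair l b \<in> elts (coproduct (FOb (Fun (FOb (Fun D) j)) k)) \<longleftrightarrow>
      l \<in> Obj (fibre (FOb (Fun D) j) k) \<and> b \<in> elts (FOb (fdiag (FOb (Fun D) j) k) l)"
    if "j \<in> Obj (Shape D)" "k \<in> Obj (Shape (FOb (Fun D) j))" for j k l b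
    using at2[OF that] by (simp add: fibre_def fdiag_def)
  \<comment> \<open>The two factors on the right describe their common object differently. That the
    descriptions agree reflects the strict naturality of the multiplication with respect to
    \<open>coproduct_functor\<close>; here it is checked on the elements of the disjoint
    unions.\<close>
  have mid: "coproduct (mu_obj Sets ?P) = coproduct (push_diagram ?e ?N)"
  proof -
    have "elts (coproduct (mu_obj Sets ?P)) = elts (coproduct (push_diagram ?e ?N))"
    proof (intro set_eqI iffI)
      fix p assume "p \<in> elts (coproduct (mu_obj Sets ?P))"
      then show "p \<in> elts (coproduct (push_diagram ?e ?N))"
        using P
      proof (rule coproduct_muE)
        fix j k b
        assume p: "p = opair (opair j k) b" "j \<in> Obj (Shape ?P)" "k \<in> Obj (fibre ?P j)"
          "b \<in> elts (FOb (fdiag ?P j) k)"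
        then have jk: "j \<in> Obj (Shape D)" "k \<in> Obj (Shape (FOb (Fun D) j))" by (simp_all add: fibP)
        from p(4) jk have "b \<in> elts (coproduct (FOb (Fun (FOb (Fun D) j)) k))" by (simp add: fdiagP)
        then show ?thesis using at2[OF jk]
          by (rule coproductE) (use p(1) jk iff[OF jk] N in
            \<open>simp add: fibN D.fibre_category fibre_def fdiag_def\<close>)
      qed
    next
      fix p assume "p \<in> elts (coproduct (push_diagram ?e ?N))"
      then show "p \<in> elts (coproduct (mu_obj Sets ?P))"
        using N
      proof (rule coproduct_pushE)
        fix i l b
        assume p: "p = opair i (opair l b)" "i \<in> Obj (Shape ?N)" "l \<in> Obj (fibre ?N i)"
          "b \<in> elts (FOb (fdiag ?N i) l)"
        from p(2) obtain j k where jk: "i = opair j k" "j \<in> Obj (Shape D)" "k \<in> Obj (Shape (FOb (Fun D) j))"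
          by (auto elim!: groth_objE simp: fibre_def[of D])
        show ?thesis using p jk P by (simp add: fibP fdiagP fibN iff)
      qed
    qed
    then show ?thesis by (rule extensionality)
  qed
  show ?thesis
  proof (rule Sets_arr_eqI)
    let ?l = "Comp Sets (FAr ?e ?a) (Comp Sets (coproduct_assoc ?M) (FAr ?e ?n))"
    let ?r = "Comp Sets (coproduct_assoc ?N) (coproduct_assoc ?P)"
    fix p assume "p \<in> elts (Dom Sets ?l)"
    then have p: "p \<in> elts (coproduct (push_diagram ?e ?P))"
      using a n M src tgt src_a by simp
    then show "app ?l p = app ?r p"
      using P
    proof (rule coproduct_pushE)
      fix j k b
      assume 1: "p = opair j (opair k b)" "j \<in> Obj (Shape ?P)" "k \<in> Obj (fibre ?P j)"
        "b \<in> elts (FOb (fdiag ?P j) k)"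
      then have jk: "j \<in> Obj (Shape D)" "k \<in> Obj (Shape (FOb (Fun D) j))" by (simp_all add: fibP)
      from 1(4) jk have "b \<in> elts (coproduct (FOb (Fun (FOb (Fun D) j)) k))" by (simp add: fdiagP)
      then show ?thesis using at2[OF jk]
      proof (rule coproductE)
        fix l c
        assume 2: "b = opair l c" "l \<in> Obj (Shape (FOb (Fun (FOb (Fun D) j)) k))"
          "c \<in> elts (FOb (Fun (FOb (Fun (FOb (Fun D) j)) k)) l)"
        then have lc: "l \<in> Obj (fibre (FOb (Fun D) j) k)" "c \<in> elts (FOb (fdiag (FOb (Fun D) j) k) l)"
          by (simp_all add: fibre_def fdiag_def)
        have k: "k \<in> Obj (Shape (FOb (Fun D) j))" by (rule jk)
        have "app (FAr ?e ?n) p = opair j (app (coproduct_assoc (FOb (Fun D) j)) (opair k (opair l c)))"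
        proof -
          \<comment> \<open>The pushed transformation acts on an element tagged \<open>j\<close>
            through the associativity map of the diagram at \<open>j\<close>. To evaluate it,
            \<open>(k, (l, c))\<close> is recognised as an element of the iterated disjoint union
            over that diagram.\<close>
          have "FOb (Fun (Src ?n)) j = coproduct (push_diagram ?e (FOb (Fun D) j))"
            using D jk(1) at[OF jk(1)] by (simp add: Obj_Diag is_diagram_push_coproduct)
          then have "opair k (opair l c) \<in> elts (FOb (Fun (Src ?n)) j)"
            using jk lc at[OF jk(1)] by (simp add: fibre_def[of "FOb (Fun D) j"] fibre_def[of D])
          then show ?thesis
            using coproduct_functor_arr(4)[OF n, of j] D jk 1(1) 2(1) by simp
        qed
        also have "\<dots> = opair j (opair (opair k l) c)"
          using at[OF jk(1)] jk lc by simp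
        finally have l1: "app (FAr ?e ?n) p = opair j (opair (opair k l) c)" .
        have l2: "app (coproduct_assoc ?M) (opair j (opair (opair k l) c)) = opair (opair j (opair k l)) c"
          using M jk lc by (simp add: fibM)
        have l3: "app (FAr ?e ?a) (opair (opair j (opair k l)) c) = opair (opair (opair j k) l) c"
          using a jk lc D M by (simp add: src_a is_category_Sets fibM)
        have r1: "app (coproduct_assoc ?P) p = opair (opair j k) (opair l c)"
          using P jk lc 1 2 by simp
        have r2: "app (coproduct_assoc ?N) (opair (opair j k) (opair l c)) = opair (opair (opair j k) l) c"
          using N jk lc by (simp add: fibN fibre_def[of D])
        have "app ?l p = opair (opair (opair j k) l) c"
          using a n M src tgt src_a p l1 l2 l3 by simp
        moreover have "app ?r p = opair (opair (opair j k) l) c"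
          using N P mid p r1 r2 by simp
        ultimately show ?thesis by simp
      qed
    qed
  qed (use a n M N P src tgt src_a tgt_a mid in simp_all)
qed

text \<open>The two laws are equations of transformations extended by \<open>undefined\<close>; on
  diagrams they are the elementwise laws already proved, and elsewhere both sides are
  \<open>undefined\<close>.\<close>

lemma pseudoalgebra_coproduct: "pseudoalgebra Sets coproduct_functor coproduct_unit coproduct_assoc"
proof (rule pseudoalgebra.intro)
  show "whisker_right (Diag Sets) coproduct_assoc (push Sets (eta Sets)) =
       vcomp (Diag Sets) Sets
         (whisker_left (Diag Sets) coproduct_functor (unitor_r Sets))
         (whisker_left (Diag Sets) coproduct_functor
           (push_nt Sets (fcomp Sets coproduct_functor (eta Sets)) (id_functor Sets) coproduct_unit))"
    by (rule ext) (simp add: whisker_right_def whisker_left_def vcomp_def Obj_Diag coproduct_unit_law restrict_def)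
next
  have "FOb (mu (Diag Sets)) D = mu_obj (Diag Sets) D"
    "FOb (push (Diag (Diag Sets)) (mu Sets)) D = push_diagram (mu Sets) D"
    "FOb (push (Diag (Diag Sets)) (push (Diag Sets) coproduct_functor)) D =
      push_diagram (push (Diag Sets) coproduct_functor) D"
    if "is_diagram (Diag (Diag Sets)) D" for D :: "('u::universe, ('u, 'u, 'u) diagram, ('u, 'u, 'u) diagram_mor) diagram2"
    using that by simp_all
  note * = this
  show "vcomp (Diag (Diag (Diag Sets))) Sets
         (whisker_left (Diag (Diag (Diag Sets))) coproduct_functor (assoc_a Sets))
         (vcomp (Diag (Diag (Diag Sets))) Sets
           (whisker_right (Diag (Diag (Diag Sets))) coproduct_assoc (push (Diag (Diag Sets)) (mu Sets)))
           (whisker_left (Diag (Diag (Diag Sets))) coproduct_functor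
             (push_nt (Diag (Diag Sets))
               (fcomp (Diag (Diag Sets)) coproduct_functor (push (Diag Sets) coproduct_functor))
               (fcomp (Diag (Diag Sets)) coproduct_functor (mu Sets)) coproduct_assoc))) =
       vcomp (Diag (Diag (Diag Sets))) Sets
         (whisker_right (Diag (Diag (Diag Sets))) coproduct_assoc (mu (Diag Sets)))
         (whisker_right (Diag (Diag (Diag Sets))) coproduct_assoc
           (push (Diag (Diag Sets)) (push (Diag Sets) coproduct_functor)))"
    by (rule ext) (simp add: whisker_right_def whisker_left_def vcomp_def Obj_Diag
      coproduct_assoc_law * restrict_def)
qed (rule is_category_Sets locally_small_Sets is_functor_coproduct nat_iso_coproduct_unit
  nat_iso_coproduct_assoc)+

section \<open>Disjoint unions are not colimits\<close>

text \<open>Each pair of objects is joined by a unique arrow, coded by the pair itself. On two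
  objects this gives a small connected shape in which every object is reached from a chosen one by a
  single arrow.\<close>

definition chaotic :: "'u::universe set \<Rightarrow> ('u, 'u) category"
  where "chaotic X =
    \<lparr>Obj = X, Arr = {opair x y | x y. x \<in> X \<and> y \<in> X},
     Dom = (\<lambda>f\<in>{opair x y | x y. x \<in> X \<and> y \<in> X}. pfst f),
     Cod = (\<lambda>f\<in>{opair x y | x y. x \<in> X \<and> y \<in> X}. psnd f),
     Ide = (\<lambda>x\<in>X. opair x x),
     Comp = (\<lambda>g f. if \<exists>x\<in>X. \<exists>y\<in>X. \<exists>z\<in>X. f = opair x y \<and> g = opair y z
       then opair (pfst f) (psnd g) else undefined)\<rparr>"

lemma chaotic_sel [simp]:
  "Obj (chaotic X) = X"
  "opair x y \<in> Arr (chaotic X) \<longleftrightarrow> x \<in> X \<and> y \<in> X"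
  "x \<in> X \<Longrightarrow> y \<in> X \<Longrightarrow> Dom (chaotic X) (opair x y) = x"
  "x \<in> X \<Longrightarrow> y \<in> X \<Longrightarrow> Cod (chaotic X) (opair x y) = y"
  "x \<in> X \<Longrightarrow> Ide (chaotic X) x = opair x x"
  "x \<in> X \<Longrightarrow> y \<in> X \<Longrightarrow> z \<in> X \<Longrightarrow> Comp (chaotic X) (opair y z) (opair x y) = opair x z"
  by (auto simp: chaotic_def)

lemma chaotic_arrE:
  assumes "f \<in> Arr (chaotic X)"
  obtains x y where "f = opair x y" "x \<in> X" "y \<in> X"
  using assms by (auto simp: chaotic_def)

lemma small_category_chaotic:
  assumes "small X"
  shows "small_category (chaotic X)"
proof -
  have "is_category (chaotic X)"
  proof (rule is_categoryI, goal_cases)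
    case (11 f g)
    have "\<not> (\<exists>x\<in>X. \<exists>y\<in>X. \<exists>z\<in>X. f = opair x y \<and> g = opair y z)"
      using 11 by auto
    then show ?case by (simp only: chaotic_def category.simps if_False)
  qed (auto elim!: chaotic_arrE, auto simp: chaotic_def)
  moreover have "small (\<Union>x\<in>X. opair x ` X)"
    using assms by (intro small_UN small_image)
  then have "small (Arr (chaotic X))"
    by (rule small_subset) (auto elim!: chaotic_arrE)
  ultimately show ?thesis using assms by (simp add: small_category_def)
qed

text \<open>All legs of a cocone on the constant one-point diagram coincide, so together they meet
  only one element of the vertex. The map collapsing the vertex to that element fixes the cocone, as
  does the identity. For a colimit the two must agree, which leaves at most one element, whereas the
  disjoint union has the elements tagged by each of the two objects.\<close>

lemma coproduct_functor_not_colimit: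
  "\<not> (colimit_choice Sets c h \<and> coproduct_functor = colimit_functor Sets c h)"
proof
  assume "colimit_choice Sets c h \<and> coproduct_functor = colimit_functor Sets c h"
  then have choice: "colimit_choice Sets c h" and eq: "coproduct_functor = colimit_functor Sets c h"
    by auto
  \<comment> \<open>The one-element set has two uses: as the constant value of the diagram and,
    being nonempty and hence different from \<open>pt\<close>, as the second object of the
    shape.\<close>
  define s :: 'a where "s = set_of {pt}"
  have s [simp]: "elts s = {pt}" unfolding s_def using small_pair[of pt "pt :: 'a"] elts_set_of[of "{pt :: 'a}"] by simp
  have "elts (pt :: 'a) = {}" unfolding pt_def
    using small_subset[OF small_pair] by (intro elts_set_of) blast
  with s have "s \<noteq> pt" by force
  let ?J = "chaotic {pt, s}"
  define D :: "('a, 'a, 'a) diagram"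
    where "D = \<lparr>Shape = ?J, Fun = \<lparr>FOb = (\<lambda>j\<in>Obj ?J. s), FAr = (\<lambda>f\<in>Arr ?J. Ide Sets s)\<rparr>\<rparr>"
  have J: "small_category ?J" using small_pair by (rule small_category_chaotic)
  then interpret J: is_category ?J by (simp add: small_category_def)
  have D: "is_diagram Sets D"
  proof (rule is_diagramI)
    show "is_functor (Shape D) Sets (Fun D)"
      by (rule is_functorI) (auto elim!: chaotic_arrE simp: D_def J.is_category_axioms is_category_Sets
        is_category.comp_ide_right[OF is_category_Sets])
  qed (simp add: D_def J)
  have obj: "pt \<in> Obj (Shape D)" "s \<in> Obj (Shape D)" "FOb (Fun D) pt = s" "FOb (Fun D) s = s"
    by (simp_all add: D_def)
  have colim: "is_colimit Sets D (c D) (h D)" using choice D by (simp add: colimit_choice_def)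
  have "FOb coproduct_functor D = FOb (colimit_functor Sets c h) D" by (simp only: eq)
  then have cD: "c D = coproduct D" using D by (simp add: colimit_functor_def Obj_Diag)
  from colim have cocone: "is_cocone Sets D (c D) (h D)" by (simp add: is_colimit_def)
  then have h: "h D j \<in> Arr Sets" "Dom Sets (h D j) = s" "Cod Sets (h D j) = c D"
    if "j \<in> Obj (Shape D)" for j
    using that by (auto simp: is_cocone_def Hom_iff D_def)
  \<comment> \<open>The shape has an arrow from \<open>pt\<close> to \<open>j\<close>, which the
    diagram sends to an identity; the cocone condition at this arrow equates the two legs.\<close>
  have const: "h D j = h D pt" if "j \<in> Obj (Shape D)" for j
  proof -
    have "opair pt j \<in> Hom (Shape D) pt j" using that by (auto simp: D_def Hom_iff)
    moreover from this have "FAr (Fun D) (opair pt j) = Ide Sets s" by (simp add: D_def Hom_iff)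
    ultimately have "Comp Sets (h D j) (Ide Sets s) = h D pt"
      using cocone unfolding is_cocone_def by metis
    then show ?thesis using h[OF that] is_category.comp_ide_right[OF is_category_Sets] by metis
  qed
  \<comment> \<open>The endomap of the vertex that is constant at the only element hit by the
    cocone; it competes with the identity in the uniqueness clause.\<close>
  define k where "k = fn (c D) (\<lambda>_. app (h D pt) pt) (c D)"
  have mem: "app (h D pt) pt \<in> elts (c D)" using app_in[of "h D pt" pt] h[OF obj(1)] by simp
  then have k: "k \<in> Hom Sets (c D) (c D)" by (simp add: k_def Hom_iff)
  have "Comp Sets k (h D j) = h D j" if "j \<in> Obj (Shape D)" for j
    by (rule Sets_arr_eqI) (use h[OF that] h[OF obj(1)] const[OF that] mem in \<open>auto simp: k_def\<close>)
  moreover have "Comp Sets (Ide Sets (c D)) (h D j) = h D j" if "j \<in> Obj (Shape D)" for j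
    using h[OF that] is_category.comp_ide_left[OF is_category_Sets] by metis
  moreover have "Ide Sets (c D) \<in> Hom Sets (c D) (c D)" by (simp add: Hom_iff)
  moreover have "\<exists>!u. u \<in> Hom Sets (c D) (c D) \<and> (\<forall>j\<in>Obj (Shape D). Comp Sets u (h D j) = h D j)"
    using colim cocone unfolding is_colimit_def by blast
  ultimately have "k = Ide Sets (c D)" using k by blast
  then have "app k p = app (Ide Sets (c D)) p" for p by simp
  then have fixed: "p = app (h D pt) pt" if "p \<in> elts (c D)" for p
    using that by (metis Ide_Sets(4) app_fn k_def)
  have "opair pt pt \<in> elts (c D)" "opair s pt \<in> elts (c D)"
    using D obj by (simp_all add: cD)
  then have "opair s pt = opair pt pt" using fixed by metis
  with \<open>s \<noteq> pt\<close> show False by simp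
qed

theorem proposition2p11:
  shows "\<exists>(A :: ('u::universe, 'u) category) e \<iota> \<gamma>.
    pseudoalgebra A e \<iota> \<gamma> \<and>
    \<not> (cocomplete A \<and> (\<exists>c h. colimit_choice A c h \<and> e = colimit_functor A c h))"
  using pseudoalgebra_coproduct coproduct_functor_not_colimit by blast

end
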